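(* Let $K=\mathbb{Q}(\sqrt D)$ with $D>1$ square-free. The following are equivalent: (i) The only well-rounded twist of $\Lambda_K$, up to similarity, is the orthogonal (square) lattice; i.e. $w(\Lambda_K)$ consists of exactly the similarity class of $\mathbb{Z}^2$. (ii) Either $D=s^2+1$ for some $s\in\mathbb{Z}$ and $D\equiv 2\pmod 4$, or $D=s^2+4$ for some $s\in\mathbb{Z}$ and $D\equiv1\pmod 4$. (iii) The regulator $R_K$ satisfies $R_K=\log\left|\tfrac12(\sqrt{D-4}+\sqrt D)\right|$ if $D\equiv1\pmod4$, and $R_K=\log|\sqrt{D-1}+\sqrt D|$ if $D\not\equiv1\pmod 4$.
   Context: $\Lambda_K=\{(x,\bar x):x\in\mathcal{O}_K\}\subset\mathbb{R}^2$, where $\bar x$ is the Galois conjugate. $R_K=\log\varepsilon$, where $\varepsilon>1$ is the fundamental unit of $\mathcal{O}_K$. For $\alpha>0$, $T_\alpha=\mathrm{diag}(\alpha,1/\alpha)$; lattices $T_\alpha\Lambda_K$ are twists. Two planar lattices are similar if one is obtained from the other by a rotation and positive scaling; a lattice is well-rounded if its minimal nonzero vectors span $\mathbb{R}^2$. $w(\Lambda_K)$ denotes the set of similarity classes of well-rounded twists of $\Lambda_K$. *)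

theory Defs
  imports "HOL-Analysis.Analysis" "HOL-Computational_Algebra.Computational_Algebra"
begin

text \<open>
  Real quadratic fields are realised inside \<^typ>\<open>real\<close>, via the embedding sending a square root
  of \<open>D\<close> to the positive one.
\<close>

definition quadratic_field :: "int \<Rightarrow> real set" where
  "quadratic_field D = {of_rat a + of_rat b * sqrt (of_int D) | a b. True}"

definition ring_of_integers :: "int \<Rightarrow> real set" where
  "ring_of_integers D = {x \<in> quadratic_field D. algebraic_int x}"

text \<open>
  The description is well defined on \<open>quadratic_field D\<close> whenever \<open>D\<close> is not a perfect square, since
  the rational coordinates are then unique.
\<close>

definition galois_conj :: "int \<Rightarrow> real \<Rightarrow> real" where
  "galois_conj D x = (THE y. \<exists>a b. x = of_rat a + of_rat b * sqrt (of_int D) \<and>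
                                   y = of_rat a - of_rat b * sqrt (of_int D))"

definition is_integral_unit :: "int \<Rightarrow> real \<Rightarrow> bool" where
  "is_integral_unit D u \<longleftrightarrow>
     u \<in> ring_of_integers D \<and> (\<exists>v \<in> ring_of_integers D. u * v = 1)"

definition fundamental_unit :: "int \<Rightarrow> real" where
  "fundamental_unit D = (THE \<epsilon>. \<epsilon> > 1 \<and>
     {u. is_integral_unit D u} = {\<epsilon> powi n | n. True} \<union> {- (\<epsilon> powi n) | n. True})"

definition regulator :: "int \<Rightarrow> real" where
  "regulator D = ln (fundamental_unit D)"

definition planar_lattice :: "(real^2) set \<Rightarrow> bool" where
  "planar_lattice L \<longleftrightarrow> (\<exists>u v. u \<noteq> v \<and> independent {u, v} \<and>
     L = {of_int m *\<^sub>R u + of_int n *\<^sub>R v | m n. True})"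

definition int_lattice :: "(real^2) set" where
  "int_lattice = {x. \<forall>i. x $ i \<in> \<int>}"

definition similarity :: "((real^2) set \<times> (real^2) set) set" where
  "similarity = {(L, M). planar_lattice L \<and> planar_lattice M \<and>
     (\<exists>c Q. c > 0 \<and> rotation_matrix Q \<and> M = (\<lambda>x. c *\<^sub>R (Q *v x)) ` L)}"

definition minimal_vectors :: "(real^2) set \<Rightarrow> (real^2) set" where
  "minimal_vectors L = {x \<in> L - {0}. \<forall>y \<in> L - {0}. norm x \<le> norm y}"

definition well_rounded :: "(real^2) set \<Rightarrow> bool" where
  "well_rounded L \<longleftrightarrow> span (minimal_vectors L) = UNIV"

definition twist :: "real \<Rightarrow> (real^2) set \<Rightarrow> (real^2) set" where
  "twist \<alpha> L = (\<lambda>x. (vector [vector [\<alpha>, 0], vector [0, 1 / \<alpha>]] :: real^2^2) *v x) ` L"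

definition well_rounded_twists :: "(real^2) set \<Rightarrow> (real^2) set set" where
  "well_rounded_twists L = {twist \<alpha> L | \<alpha>. \<alpha> > 0 \<and> well_rounded (twist \<alpha> L)}"

text \<open>The set \<open>w(L)\<close> of similarity classes of well-rounded twists.\<close>

definition wr_classes :: "(real^2) set \<Rightarrow> (real^2) set set set" where
  "wr_classes L = well_rounded_twists L // similarity"

definition field_lattice :: "int \<Rightarrow> (real^2) set" where
  "field_lattice D = {vector [x, galois_conj D x] | x. x \<in> ring_of_integers D}"

end

theory Submission
  imports Defs
begin

text \<open>
  Write \<open>x'\<close> for the conjugate of \<open>x\<close> and \<open>\<beta> = \<alpha>\<^sup>4\<close>: up to scaling, the squared length of the vector of
  \<open>x\<close> in the twist by \<open>\<alpha>\<close> is \<open>\<beta> x\<^sup>2 + x'\<^sup>2\<close>. At \<open>\<beta> = 1\<close> the vectors of \<open>1\<close> and \<open>-1\<close> are the only minimal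
  ones. Increase \<open>\<beta>\<close> until another vector, that of \<open>y\<close>, becomes as short; this twist is well-rounded.
  If it is similar to the square lattice, then \<open>1, y\<close> is an orthogonal basis of it, which forces
  \<open>y y' = -1\<close>, and writing \<open>y\<close> in terms of the standard basis of the ring of integers gives \<open>D = c\<^sup>2 + 4\<close>
  or \<open>D = c\<^sup>2 + 1\<close>.

  Conversely, for such \<open>D\<close> the ring of integers is generated by a unit \<open>w > 1\<close> of norm \<open>-1\<close>.
  The twist with \<open>\<beta> = w\<^sup>-\<^sup>2\<close> is square, and so is the one with \<open>\<beta> = w\<^sup>2\<close>, as multiplication by \<open>w\<close>
  permutes the lattice; since lengths are affine in \<open>\<beta>\<close>, strictly between the two only \<open>1\<close> and \<open>-1\<close> are
  minimal. Up to multiplication by powers of \<open>w\<close> this covers all twists. The same \<open>w\<close> is the smallest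
  unit greater than \<open>1\<close>, hence the fundamental unit. Finally, if the regulator is as in (iii), then
  \<open>\<surd>(D - 4)\<close> or \<open>\<surd>(D - 1)\<close> lies in the field, hence is an integer.
\<close>

section \<open>Integers of a real quadratic field\<close>

text \<open>With \<open>q = h / d\<close> in lowest terms, \<open>d ^ k\<close> must divide
  \<open>M\<close> for every \<open>k\<close>, which leaves only \<open>d = 1\<close>.\<close>

lemma int_if_powers_bounded_denominator:
  fixes q :: real and M :: int
  assumes "q \<in> \<rat>" "M > 0" and M: "\<And>k. of_int M * q ^ k \<in> \<int>"
  shows "q \<in> \<int>"
proof -
  obtain h d :: int where d: "d > 0" "coprime h d" and q: "q = of_int h / of_int d"
    using \<open>q \<in> \<rat>\<close> by (metis Rats_cases')
  have dvd: "d ^ k dvd M" for k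
  proof -
    obtain z where "of_int M * q ^ k = of_int z" using M[of k] Ints_cases by blast
    then have "of_int (M * h ^ k) = (of_int (z * d ^ k) :: real)"
      using d by (simp add: q field_simps)
    then have "M * h ^ k = z * d ^ k" by (simp only: of_int_eq_iff)
    then have "d ^ k dvd M * h ^ k" by simp
    moreover have "coprime (d ^ k) (h ^ k)" using d by (simp add: coprime_commute)
    ultimately show ?thesis using coprime_dvd_mult_left_iff by blast
  qed
  have "d = 1"
  proof (rule ccontr)
    assume "d \<noteq> 1"
    then have "d \<ge> 2" using d by simp
    \<comment> \<open>The exponent \<open>k = M\<close> already gives a contradiction, because
      \<open>2 ^ M > M\<close>.\<close>
    have "int (nat M) < 2 ^ nat M" using less_exp[of "nat M"] by (metis of_nat_less_iff of_nat_numeral of_nat_power)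
    also have "\<dots> \<le> d ^ nat M" using \<open>d \<ge> 2\<close> by (intro power_mono) auto
    also have "\<dots> \<le> M" using dvd \<open>M > 0\<close> zdvd_imp_le by blast
    finally show False using \<open>M > 0\<close> by simp
  qed
  then show ?thesis using q by simp
qed

locale real_quadratic =
  fixes D :: int
  assumes D_gt_1: "D > 1" and squarefree_D: "squarefree D"
begin

definition s :: real where "s = sqrt (of_int D)"

lemma s_sq: "s * s = of_int D" and s_pos: "s > 0"
  using D_gt_1 by (auto simp: s_def)

lemma D_not_square: "D \<noteq> c\<^sup>2"
proof
  assume "D = c\<^sup>2"
  with squarefree_D have "is_unit c" by (simp add: squarefree_def)
  then have "c\<^sup>2 = 1" by (metis abs_1 power2_abs power_one zdvd1_eq)
  with \<open>D = c\<^sup>2\<close> show False using D_gt_1 by simp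
qed

lemma s_irrational: "s \<notin> \<rat>"
proof
  assume "s \<in> \<rat>"
  moreover have "algebraic_int s" by (auto simp: s_def)
  ultimately obtain c where "s = of_int c" using rational_algebraic_int_is_int Ints_cases by blast
  then have "of_int D = (of_int (c\<^sup>2) :: real)" using s_sq by (simp add: power2_eq_square)
  then show False using D_not_square by (simp only: of_int_eq_iff)
qed

lemma coords_zero:
  assumes "a \<in> \<rat>" "b \<in> \<rat>" "a + b * s = 0"
  shows "a = 0 \<and> b = 0"
proof (cases "b = 0")
  case False
  then have "s = - a / b" using assms by (simp add: field_simps)
  then show ?thesis using assms s_irrational by simp
qed (use assms in simp)

lemma coords_unique:
  assumes "a \<in> \<rat>" "b \<in> \<rat>" "c \<in> \<rat>" "d \<in> \<rat>" "a + b * s = c + d * s"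
  shows "a = c \<and> b = d"
  using coords_zero[of "a - c" "b - d"] assms by (simp add: algebra_simps)

lemma mem_quadratic_field: "x \<in> quadratic_field D \<longleftrightarrow> (\<exists>a\<in>\<rat>. \<exists>b\<in>\<rat>. x = a + b * s)"
  unfolding quadratic_field_def s_def by (auto simp: Rats_def)

lemma galois_conj_eq:
  assumes "a \<in> \<rat>" "b \<in> \<rat>"
  shows "galois_conj D (a + b * s) = a - b * s"
proof -
  obtain a' b' where ab: "a = of_rat a'" "b = of_rat b'"
    using assms by (auto simp: Rats_def)
  show ?thesis
    unfolding galois_conj_def s_def[symmetric] ab
  proof (rule the_equality)
    fix y assume "\<exists>a b. of_rat a' + of_rat b' * s = of_rat a + of_rat b * s \<and> y = of_rat a - of_rat b * s"
    then obtain a b where "of_rat a' + of_rat b' * s = of_rat a + of_rat b * s" "y = of_rat a - of_rat b * s"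
      by blast
    then show "y = of_rat a' - of_rat b' * s"
      using coords_unique[of "of_rat a'" "of_rat b'" "of_rat a" "of_rat b"] by simp
  qed blast
qed

text \<open>\<open>R\<close> is \<open>\<rat>\<close> for the field itself and \<open>\<int>\<close>
  for the order generated by \<open>s\<close>. A relation on pairs lets an element and its conjugate
  be followed through sums and products together.\<close>

definition conj_pair :: "real set \<Rightarrow> real \<Rightarrow> real \<Rightarrow> bool" where
  "conj_pair R x y \<longleftrightarrow> (\<exists>a\<in>R. \<exists>b\<in>R. x = a + b * s \<and> y = a - b * s)"

lemma conj_pair_mult:
  assumes "conj_pair R x y" "conj_pair R x' y'" and R: "R = \<rat> \<or> R = \<int>"
  shows "conj_pair R (x * x') (y * y')"
proof -
  from assms obtain a b c d where ab: "a \<in> R" "b \<in> R" "c \<in> R" "d \<in> R"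
    "x = a + b * s" "y = a - b * s" "x' = c + d * s" "y' = c - d * s"
    by (auto simp: conj_pair_def)
  have mem: "a * c + b * d * of_int D \<in> R" "a * d + b * c \<in> R" using ab R by auto
  have "x * x' = (a * c + b * d * of_int D) + (a * d + b * c) * s"
       "y * y' = (a * c + b * d * of_int D) - (a * d + b * c) * s"
    unfolding ab s_sq[symmetric] by (simp_all add: algebra_simps)
  with mem show ?thesis unfolding conj_pair_def by blast
qed

lemma conj_pair_add:
  assumes "conj_pair R x y" "conj_pair R x' y'" and R: "R = \<rat> \<or> R = \<int>"
  shows "conj_pair R (x + x') (y + y')"
proof -
  from assms obtain a b c d where ab: "a \<in> R" "b \<in> R" "c \<in> R" "d \<in> R"
    "x = a + b * s" "y = a - b * s" "x' = c + d * s" "y' = c - d * s"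
    by (auto simp: conj_pair_def)
  have mem: "a + c \<in> R" "b + d \<in> R" using ab R by auto
  have "x + x' = (a + c) + (b + d) * s" "y + y' = (a + c) - (b + d) * s"
    unfolding ab by (simp_all add: algebra_simps)
  with mem show ?thesis unfolding conj_pair_def by blast
qed

lemma conj_pair_const: "a \<in> R \<Longrightarrow> 0 \<in> R \<Longrightarrow> conj_pair R a a"
  unfolding conj_pair_def by (metis add_0_right diff_0_right mult_zero_left)

lemma conj_pair_power:
  assumes "conj_pair R x y" and R: "R = \<rat> \<or> R = \<int>"
  shows "conj_pair R (x ^ k) (y ^ k)"
proof (induction k)
  case 0 then show ?case using conj_pair_const[of 1 R] R by auto
next
  case (Suc k) then show ?case using conj_pair_mult[OF assms(1) Suc R] by simp
qed

lemma conj_pair_sum: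
  assumes "\<And>i. i \<in> I \<Longrightarrow> conj_pair R (f i) (g i)" and R: "R = \<rat> \<or> R = \<int>"
  shows "conj_pair R (sum f I) (sum g I)"
proof (cases "finite I")
  case True
  then show ?thesis using assms(1)
  proof (induction I)
    case empty then show ?case using conj_pair_const[of 0 R] R by auto
  next
    case (insert i I) then show ?case using conj_pair_add[OF _ _ R] by simp
  qed
next
  case False then show ?thesis using conj_pair_const[of 0 R] R by auto
qed

lemma conj_pair_eq_0:
  assumes "conj_pair \<rat> x y" "x = 0"
  shows "y = 0"
  using assms coords_zero unfolding conj_pair_def by force

lemma conj_pair_norm_int:
  assumes "conj_pair \<int> x y"
  shows "x * y \<in> \<int>"
proof -
  from assms obtain a b where ab: "a \<in> \<int>" "b \<in> \<int>" "x = a + b * s" "y = a - b * s"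
    by (auto simp: conj_pair_def)
  have "x * y = a * a - b * b * of_int D" unfolding ab s_sq[symmetric] by (simp add: algebra_simps)
  then show ?thesis using ab by simp
qed

text \<open>The powers of an integral element have bounded denominators, hence so have the powers of its
  norm, and of the norm of its successor.\<close>

lemma trace_norm_int:
  assumes x: "algebraic_int x" and xy: "conj_pair \<rat> x y"
  shows "x * y \<in> \<int>" "x + y \<in> \<int>"
proof -
  obtain p :: "real poly" where p: "lead_coeff p = 1" "\<And>i. coeff p i \<in> \<int>" "poly p x = 0"
    using x by (auto simp: algebraic_int.simps)
  have R: "(\<rat>::real set) = \<rat> \<or> (\<rat>::real set) = \<int>" "(\<int>::real set) = \<rat> \<or> (\<int>::real set) = \<int>" by auto
  \<comment> \<open>Conjugation fixes the rational coefficients of \<open>p\<close>, so the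
    conjugate of a root is again a root.\<close>
  have "conj_pair \<rat> (poly p x) (poly p y)"
    unfolding poly_altdef
    by (intro conj_pair_sum conj_pair_mult conj_pair_power xy conj_pair_const R)
       (use p(2) Ints_subset_Rats in auto)
  then have py: "poly p y = 0" using p(3) conj_pair_eq_0 by blast
  define d where "d = degree p"
  \<comment> \<open>As \<open>p\<close> is monic with integral coefficients, every power from the
    \<open>d\<close>-th on is an integral combination of the \<open>d\<close> powers before
    it.\<close>
  have rec: "z ^ (d + j) = (\<Sum>i<d. (- coeff p i) * z ^ (i + j))" if "poly p z = 0" for z j
  proof -
    have "0 = z ^ j * (\<Sum>i\<le>d. coeff p i * z ^ i)" using that by (simp add: poly_altdef d_def)
    also have "\<dots> = (\<Sum>i<d. coeff p i * z ^ (i + j)) + z ^ (d + j)"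
      using p(1) by (simp add: d_def lessThan_Suc_atMost[symmetric] sum_distrib_left power_add algebra_simps)
    finally show ?thesis by (simp add: sum_negf)
  qed
  obtain a b where ab: "a \<in> \<rat>" "b \<in> \<rat>" "x = a + b * s" "y = a - b * s"
    using xy by (auto simp: conj_pair_def)
  obtain a1 a2 :: int where a: "a2 > 0" "a = of_int a1 / of_int a2" using ab(1) by (metis Rats_cases')
  obtain b1 b2 :: int where b: "b2 > 0" "b = of_int b1 / of_int b2" using ab(2) by (metis Rats_cases')
  define M0 where "M0 = a2 * b2"
  \<comment> \<open>\<open>M0\<close> clears the denominators of \<open>x\<close> and
    \<open>y\<close>, so \<open>M0 ^ d\<close> clears those of all powers below the
    \<open>d\<close>-th; the recurrence extends this to all powers.\<close>
  define M where "M = M0 ^ d"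
  have M0: "M0 > 0" and M: "M > 0" using a b by (auto simp: M0_def M_def)
  have "of_int M0 * x = of_int (a1 * b2) + of_int (b1 * a2) * s"
       "of_int M0 * y = of_int (a1 * b2) - of_int (b1 * a2) * s"
    using a(1) b(1) unfolding ab(3,4) a(2) b(2) by (simp_all add: M0_def field_simps)
  then have M0x: "conj_pair \<int> (of_int M0 * x) (of_int M0 * y)" unfolding conj_pair_def by (metis Ints_of_int)
  have pow: "conj_pair \<int> (of_int M * x ^ k) (of_int M * y ^ k)" for k
  proof (induction k rule: less_induct)
    case (less k)
    show ?case
    proof (cases "k < d")
      case True
      have eq: "of_int M * z ^ k = of_int (M0 ^ (d - k)) * (of_int M0 * z) ^ k" for z :: real
      proof -
        have "M = M0 ^ (d - k) * M0 ^ k" using True by (simp add: M_def flip: power_add)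
        then show ?thesis by (simp add: power_mult_distrib)
      qed
      show ?thesis unfolding eq
        by (intro conj_pair_mult conj_pair_power M0x conj_pair_const R) auto
    next
      case False
      then obtain j where j: "k = d + j" using le_Suc_ex not_less by blast
      have eq: "of_int M * z ^ k = (\<Sum>i<d. (- coeff p i) * (of_int M * z ^ (i + j)))" if "poly p z = 0" for z
        unfolding j rec[OF that] by (simp add: sum_distrib_left algebra_simps)
      show ?thesis unfolding eq[OF p(3)] eq[OF py]
        by (intro conj_pair_sum conj_pair_mult conj_pair_const less R) (use p(2) j in auto)
    qed
  qed
  have pow1: "conj_pair \<int> (of_int M * (x + 1) ^ k) (of_int M * (y + 1) ^ k)" for k
  proof -
    have eq: "of_int M * (z + 1) ^ k = (\<Sum>i\<le>k. of_nat (k choose i) * (of_int M * z ^ i))" for z :: real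
      by (simp only: binomial_ring[of z 1] sum_distrib_left power_one mult_1_right mult_1_left mult_ac)
    show ?thesis unfolding eq
      by (intro conj_pair_sum conj_pair_mult conj_pair_const pow R) auto
  qed
  \<comment> \<open>The powers of \<open>z\<close> and of \<open>z'\<close> each take one factor
    \<open>M\<close>, hence the common denominator \<open>M * M\<close>.\<close>
  have norm: "z * z' \<in> \<int>"
    if zpow: "\<And>k. conj_pair \<int> (of_int M * z ^ k) (of_int M * z' ^ k)" and zz: "conj_pair \<rat> z z'" for z z'
  proof (rule int_if_powers_bounded_denominator[where M = "M * M"])
    obtain u v where uv: "u \<in> \<rat>" "v \<in> \<rat>" "z = u + v * s" "z' = u - v * s"
      using zz by (auto simp: conj_pair_def)
    have "z * z' = u * u - v * v * of_int D" unfolding uv s_sq[symmetric] by (simp add: algebra_simps)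
    then show "z * z' \<in> \<rat>" using uv by simp
    show "of_int (M * M) * (z * z') ^ k \<in> \<int>" for k
      using conj_pair_norm_int[OF zpow[of k]] by (simp add: power_mult_distrib mult_ac)
  qed (use M in simp)
  show xy_int: "x * y \<in> \<int>" by (rule norm[OF pow xy])
  \<comment> \<open>The trace is recovered from two norms:
    \<open>(x + 1) * (y + 1) = x * y + (x + y) + 1\<close>.\<close>
  have "(x + 1) * (y + 1) \<in> \<int>"
    by (rule norm[OF pow1], rule conj_pair_add[OF xy]) (use conj_pair_const in auto)
  then have "(x + 1) * (y + 1) - x * y - 1 \<in> \<int>" using xy_int by (intro Ints_diff) auto
  then show "x + y \<in> \<int>" by (simp add: algebra_simps)
qed

text \<open>Integral trace and norm make \<open>2 * a\<close> and \<open>D * (2 * b)^2\<close>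
  integers, and since \<open>D\<close> is square-free, \<open>2 * b\<close> then has denominator 1.
  Conversely, \<open>x\<close> is a root of \<open>X^2 - m X + N\<close> with
  \<open>4 * N = m^2 - D * n^2\<close>.\<close>

lemma ring_of_integers_iff:
  "x \<in> ring_of_integers D \<longleftrightarrow>
     (\<exists>m n :: int. 4 dvd m\<^sup>2 - D * n\<^sup>2 \<and> x = of_int m / 2 + of_int n / 2 * s)"
proof
  assume "x \<in> ring_of_integers D"
  then obtain a b where ab: "a \<in> \<rat>" "b \<in> \<rat>" "x = a + b * s" "algebraic_int x"
    by (auto simp: ring_of_integers_def mem_quadratic_field)
  then have "conj_pair \<rat> x (a - b * s)" unfolding conj_pair_def by blast
  from trace_norm_int[OF ab(4) this]
  obtain m N where m: "x + (a - b * s) = of_int m" and N: "x * (a - b * s) = of_int N"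
    by (metis Ints_cases)
  have a: "a = of_int m / 2" using m ab by simp
  have "of_int N = a * a - of_int D * (b * b)"
    unfolding N[symmetric] ab(3) s_sq[symmetric] by (simp add: algebra_simps)
  then have Db: "of_int D * (2 * b) * (2 * b) = of_int (m\<^sup>2 - 4 * N)"
    by (simp add: a power2_eq_square)
  have "2 * b \<in> \<rat>" using ab by simp
  then obtain h e :: int where e: "e > 0" "coprime h e" "2 * b = of_int h / of_int e"
    by (metis Rats_cases')
  have "of_int (D * h\<^sup>2) = (of_int ((m\<^sup>2 - 4 * N) * e\<^sup>2) :: real)"
  proof -
    have h: "of_int h = 2 * b * of_int e" using e by simp
    have "of_int (D * h\<^sup>2) = of_int D * (2 * b) * (2 * b) * (of_int e)\<^sup>2"
      by (simp add: h power2_eq_square)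
    then show ?thesis unfolding Db by simp
  qed
  then have Dh: "D * h\<^sup>2 = (m\<^sup>2 - 4 * N) * e\<^sup>2" by (simp only: of_int_eq_iff)
  then have "e\<^sup>2 dvd D * h\<^sup>2" by simp
  moreover have "coprime (e\<^sup>2) (h\<^sup>2)" using e by (simp add: coprime_commute)
  ultimately have "e\<^sup>2 dvd D" using coprime_dvd_mult_left_iff by blast
  then have "is_unit e" using squarefree_D by (auto simp: squarefree_def)
  then have "e = 1" using e by simp
  then have "b = of_int h / 2" "m\<^sup>2 - D * h\<^sup>2 = 4 * N" using e Dh by auto
  then show "\<exists>m n :: int. 4 dvd m\<^sup>2 - D * n\<^sup>2 \<and> x = of_int m / 2 + of_int n / 2 * s"
    using ab a by (metis dvd_triv_left)
next
  assume "\<exists>m n :: int. 4 dvd m\<^sup>2 - D * n\<^sup>2 \<and> x = of_int m / 2 + of_int n / 2 * s"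
  then obtain m n N :: int where mn: "m\<^sup>2 - D * n\<^sup>2 = 4 * N" "x = of_int m / 2 + of_int n / 2 * s"
    by (auto elim: dvdE)
  have "of_int (m\<^sup>2 - D * n\<^sup>2) = (of_int (4 * N) :: real)" using mn by simp
  then have N: "of_int N = (of_int m)\<^sup>2 / 4 - of_int D * (of_int n)\<^sup>2 / (4::real)" by simp
  have "algebraic_int x"
  proof (rule algebraic_int.intros)
    show "poly [:of_int N, - of_int m, 1:] x = 0"
      unfolding mn(2) N s_sq[symmetric] by (simp add: field_simps power2_eq_square)
    show "\<forall>i. coeff [:of_int N, - of_int m, 1 :: real:] i \<in> \<int>"
      by (auto simp: coeff_pCons split: nat.splits)
  qed simp
  moreover have "x \<in> quadratic_field D"
    unfolding mem_quadratic_field mn(2) by (intro bexI[of _ "of_int m / 2"] bexI[of _ "of_int n / 2"]) auto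
  ultimately show "x \<in> ring_of_integers D" by (simp add: ring_of_integers_def)
qed

lemma D_mod_4: "D mod 4 \<noteq> 0"
proof
  assume "D mod 4 = 0"
  then have "2\<^sup>2 dvd D" by auto
  then have "is_unit (2::int)" using squarefree_D unfolding squarefree_def by blast
  then show False by simp
qed

text \<open>Squares are 0 or 1 modulo 4, so only the parities and \<open>D mod 4\<close> matter.
  This separates the two shapes of the ring of integers.\<close>

lemma four_dvd_norm_iff:
  "4 dvd m\<^sup>2 - D * n\<^sup>2 \<longleftrightarrow> (if D mod 4 = 1 then even (m - n) else even m \<and> even n)"
proof -
  have ev: "4 dvd c\<^sup>2" if "even c" for c :: int using that by (auto elim!: evenE simp: power2_eq_square)
  have od: "c\<^sup>2 mod 4 = 1" if "odd c" for c :: int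
    using that by (auto elim!: oddE simp: power2_eq_square algebra_simps mod_add_eq[symmetric] mod_mult_right_eq)
  have sq: "c\<^sup>2 mod 4 = (if even c then 0 else 1)" for c :: int
    using ev od by (auto simp: dvd_eq_mod_eq_0)
  have m: "(m\<^sup>2 - D * n\<^sup>2) mod 4 = (m\<^sup>2 mod 4 - (D mod 4) * (n\<^sup>2 mod 4)) mod 4"
    by (intro mod_diff_cong mod_mult_cong) simp_all
  have "4 dvd m\<^sup>2 - D * n\<^sup>2 \<longleftrightarrow>
      ((if even m then 0 else 1) - (D mod 4) * (if even n then 0 else 1)) mod 4 = 0"
    unfolding dvd_eq_mod_eq_0[of 4] m sq ..
  moreover have "D mod 4 = 1 \<or> D mod 4 = 2 \<or> D mod 4 = 3"
    using D_mod_4 pos_mod_bound[of 4 D] pos_mod_sign[of 4 D] by presburger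
  ultimately show ?thesis by (elim disjE; cases "even m"; cases "even n") simp_all
qed

end

section \<open>Quadratic orders and their units\<close>

text \<open>The order \<open>Z[w]\<close> for a root \<open>w\<close> of
  \<open>X^2 - t X + n\<close>, with \<open>w'\<close> the other root. \<open>D\<close> does not
  occur, so the rings of integers for both kinds of residue of \<open>D\<close> modulo 4 become
  instances.\<close>

locale quadratic_order =
  fixes w w' :: real and t n :: int
  assumes trace: "w + w' = of_int t" and norm: "w * w' = of_int n"
    and irrational: "w \<notin> \<rat>" and conj_less: "w' < w"
begin

text \<open>An element of the order is represented by its values under the two real embeddings;
  irrationality of \<open>w\<close> makes the second value a function of the first.\<close>

definition mem :: "real \<Rightarrow> real \<Rightarrow> bool" where
  "mem x x' \<longleftrightarrow> (\<exists>a b :: int. x = of_int a + of_int b * w \<and> x' = of_int a + of_int b * w')"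

lemma memI: "mem (of_int a + of_int b * w) (of_int a + of_int b * w')"
  unfolding mem_def by blast

lemma mem_int: "mem (of_int a) (of_int a)"
  using memI[of a 0] by simp

lemma mem_0: "mem 0 0" and mem_1: "mem 1 1" and mem_minus_1: "mem (-1) (-1)"
  using mem_int[of 0] mem_int[of 1] mem_int[of "-1"] by auto

lemma mem_gen: "mem w w'"
  using memI[of 0 1] by simp

lemma w_sq: "w * w = of_int t * w - of_int n" and w'_sq: "w' * w' = of_int t * w' - of_int n"
  using trace norm by (auto simp flip: trace norm simp: algebra_simps)

lemma mem_add:
  assumes "mem x x'" "mem y y'"
  shows "mem (x + y) (x' + y')"
proof -
  obtain a b c d :: int where xy: "x = of_int a + of_int b * w" "x' = of_int a + of_int b * w'"
    "y = of_int c + of_int d * w" "y' = of_int c + of_int d * w'"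
    using assms by (auto simp: mem_def)
  show ?thesis using memI[of "a + c" "b + d"] unfolding xy by (simp add: algebra_simps)
qed

lemma mem_mult: "mem x x' \<Longrightarrow> mem y y' \<Longrightarrow> mem (x * y) (x' * y')"
  unfolding mem_def
proof (elim exE conjE)
  fix a b c d :: int
  assume xy: "x = of_int a + of_int b * w" "x' = of_int a + of_int b * w'"
    "y = of_int c + of_int d * w" "y' = of_int c + of_int d * w'"
  have *: "(of_int a + of_int b * z) * (of_int c + of_int d * z) =
      of_int (a * c - b * d * n) + of_int (a * d + b * c + b * d * t) * z"
    if "z * z = of_int t * z - of_int n" for z :: real
  proof -
    have "(of_int a + of_int b * z) * (of_int c + of_int d * z) =
      of_int (a * c) + of_int (a * d + b * c) * z + of_int (b * d) * (z * z)" by (simp add: algebra_simps)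
    then show ?thesis unfolding that by (simp add: algebra_simps)
  qed
  show "\<exists>a b. x * y = of_int a + of_int b * w \<and> x' * y' = of_int a + of_int b * w'"
    unfolding xy *[OF w_sq] *[OF w'_sq] by blast
qed

lemma mem_minus: "mem x x' \<Longrightarrow> mem (- x) (- x')"
  using mem_mult[OF mem_minus_1] by simp

lemma mem_diff: "mem x x' \<Longrightarrow> mem y y' \<Longrightarrow> mem (x - y) (x' - y')"
  using mem_add[OF _ mem_minus] by simp

lemma mem_conj:
  assumes "mem x x'"
  shows "mem x' x"
proof -
  obtain a b :: int where x: "x = of_int a + of_int b * w" "x' = of_int a + of_int b * w'"
    using assms by (auto simp: mem_def)
  have w': "w' = of_int t - w" using trace by simp
  show ?thesis using memI[of "a + b * t" "- b"] unfolding x w' by (simp add: algebra_simps)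
qed

lemma coords_eq:
  assumes "of_int a + of_int b * w = of_int c + of_int d * w"
  shows "a = c \<and> b = d"
proof (cases "b = d")
  case False
  have "of_int (b - d) * w = of_int (c - a)" using assms by (simp add: algebra_simps)
  then have "w = of_int (c - a) / of_int (b - d)" using False by (simp add: field_simps)
  then show ?thesis using irrational by simp
qed (use assms in simp)

lemma mem_unique: "mem x x' \<Longrightarrow> mem x x'' \<Longrightarrow> x' = x''"
  unfolding mem_def using coords_eq by metis

lemma mem_eq_0_iff: "mem x x' \<Longrightarrow> x = 0 \<longleftrightarrow> x' = 0"
  using mem_unique mem_conj mem_0 by metis

lemma mem_rational:
  assumes "mem x x'" "x \<in> \<rat>"
  shows "x \<in> \<int>"
proof -
  obtain a b :: int where ab: "x = of_int a + of_int b * w" using assms(1) by (auto simp: mem_def)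
  have "b = 0"
  proof (rule ccontr)
    assume "b \<noteq> 0"
    then have "w = (x - of_int a) / of_int b" using ab by (simp add: field_simps)
    then show False using irrational assms(2) by simp
  qed
  then show ?thesis using ab by simp
qed

lemma mem_norm_int: "mem x x' \<Longrightarrow> x * x' \<in> \<int>"
proof (elim mem_def[THEN iffD1, elim_format] exE conjE)
  fix a b :: int
  assume xy: "x = of_int a + of_int b * w" "x' = of_int a + of_int b * w'"
  have "x * x' = of_int (a * a) + of_int (a * b) * (w + w') + of_int (b * b) * (w * w')"
    unfolding xy by (simp add: algebra_simps)
  then show ?thesis unfolding trace norm by simp
qed

lemma mem_norm_ge_1:
  assumes "mem x x'" "x \<noteq> 0"
  shows "\<bar>x * x'\<bar> \<ge> 1"
proof -
  obtain k where k: "x * x' = of_int k" using mem_norm_int[OF assms(1)] Ints_cases by blast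
  moreover have "x * x' \<noteq> 0" using assms mem_eq_0_iff by auto
  ultimately have "\<bar>k\<bar> \<ge> 1" by auto
  then show ?thesis unfolding k by simp
qed

text \<open>The coordinates satisfy \<open>b = (x - x') / (w - w')\<close> and
  \<open>a = x - b * w\<close>, so bounds on both embeddings bound both coordinates.\<close>

lemma finite_mem_bounded: "finite {(x, x'). mem x x' \<and> \<bar>x\<bar> \<le> C \<and> \<bar>x'\<bar> \<le> C}"
proof -
  define B where "B = \<lceil>2 * C / (w - w')\<rceil>"
  define A where "A = \<lceil>C + of_int B * \<bar>w\<bar>\<rceil>"
  have "{(x, x'). mem x x' \<and> \<bar>x\<bar> \<le> C \<and> \<bar>x'\<bar> \<le> C} \<subseteq>
    (\<lambda>(a, b). (of_int a + of_int b * w, of_int a + of_int b * w')) ` ({-A..A} \<times> {-B..B})"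
  proof clarify
    fix x x' assume x: "mem x x'" "\<bar>x\<bar> \<le> C" "\<bar>x'\<bar> \<le> C"
    then obtain a b where ab: "x = of_int a + of_int b * w" "x' = of_int a + of_int b * w'"
      by (auto simp: mem_def)
    have "x - x' = of_int b * (w - w')" unfolding ab by (simp add: algebra_simps)
    then have "\<bar>of_int b\<bar> * (w - w') = \<bar>x - x'\<bar>" using conj_less by (simp add: abs_mult)
    also have "\<dots> \<le> 2 * C" using x by simp
    finally have "\<bar>of_int b\<bar> \<le> 2 * C / (w - w')" using conj_less by (simp add: field_simps)
    then have "of_int \<bar>b\<bar> \<le> (of_int B :: real)" unfolding B_def by (simp add: le_ceiling_iff) linarith
    then have b: "\<bar>b\<bar> \<le> B" by (simp only: of_int_le_iff)
    have "\<bar>of_int a\<bar> \<le> \<bar>x\<bar> + \<bar>of_int b * w\<bar>" unfolding ab by simp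
    also have "\<dots> \<le> C + of_int B * \<bar>w\<bar>"
      unfolding abs_mult using x b by (intro add_mono mult_right_mono) (auto simp flip: of_int_abs)
    finally have "of_int \<bar>a\<bar> \<le> (of_int A :: real)" unfolding A_def by linarith
    then have a: "\<bar>a\<bar> \<le> A" by (simp only: of_int_le_iff)
    have "(a, b) \<in> {-A..A} \<times> {-B..B}" using a b by auto
    then show "(x, x') \<in> (\<lambda>(a, b). (of_int a + of_int b * w, of_int a + of_int b * w')) ` ({-A..A} \<times> {-B..B})"
      unfolding ab by force
  qed
  then show ?thesis by (rule finite_subset) simp
qed

section \<open>Units of a quadratic order\<close>

definition unit :: "real \<Rightarrow> real \<Rightarrow> bool" where
  "unit u u' \<longleftrightarrow> mem u u' \<and> \<bar>u * u'\<bar> = 1"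

lemma unit_mem: "unit u u' \<Longrightarrow> mem u u'" by (simp add: unit_def)

lemma unit_nz: "unit u u' \<Longrightarrow> u \<noteq> 0 \<and> u' \<noteq> 0" by (auto simp: unit_def)

lemma unit_1: "unit 1 1" by (simp add: unit_def mem_1)

lemma unit_minus: "unit u u' \<Longrightarrow> unit (-u) (-u')"
  by (simp add: unit_def mem_minus)

lemma unit_mult: "unit u u' \<Longrightarrow> unit v v' \<Longrightarrow> unit (u * v) (u' * v')"
proof -
  assume a: "unit u u'" "unit v v'"
  have "\<bar>(u * v) * (u' * v')\<bar> = \<bar>u * u'\<bar> * \<bar>v * v'\<bar>" by (simp add: abs_mult)
  with a show ?thesis unfolding unit_def by (simp add: mem_mult)
qed

lemma unit_inverse:
  assumes "unit u u'"
  shows "unit (1 / u) (1 / u')"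
proof -
  have nz: "u \<noteq> 0" "u' \<noteq> 0" using unit_nz[OF assms] by auto
  have "u * u' = 1 \<or> u * u' = -1" using assms by (auto simp: unit_def)
  then have "(1 / u = u' \<and> 1 / u' = u) \<or> (1 / u = - u' \<and> 1 / u' = - u)"
    using nz by (auto simp: field_simps)
  moreover have "mem u' u" using assms by (simp add: unit_def mem_conj)
  ultimately have "mem (1 / u) (1 / u')" using mem_minus by auto
  then show ?thesis using assms by (simp add: unit_def abs_mult)
qed

lemma unit_powi: "unit u u' \<Longrightarrow> unit (u powi k) (u' powi k)"
proof -
  assume u: "unit u u'"
  have pos: "unit (v ^ j) (v' ^ j)" if "unit v v'" for v v' j
    by (induction j) (use that unit_1 unit_mult in auto)
  show ?thesis
    using pos[OF u, of "nat k"] pos[OF unit_inverse[OF u], of "nat (- k)"]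
    by (auto simp: power_int_def inverse_eq_divide)
qed

lemma unit_abs:
  assumes "unit u u'" obtains u'' where "unit \<bar>u\<bar> u''"
  using assms unit_minus by (cases "u \<ge> 0") (auto simp: abs_if)

text \<open>By Dirichlet's theorem the elements \<open>h - k * w\<close> attached to good approximations \<open>h / k\<close> of
  \<open>w\<close> have bounded norm, so that by the pigeonhole principle two of them have the same norm \<open>N\<close> and are
  congruent modulo \<open>N\<close>; their quotient is a unit.\<close>

lemma ex_unit_gt_1: "\<exists>u u'. unit u u' \<and> u > 1"
proof -
  define el where "el = (\<lambda>(h, k). of_int h - of_int k * w)"
  define el' where "el' = (\<lambda>(h, k). of_int h - of_int k * w')"
  have mem_el: "mem (el p) (el' p)" for p
    using memI[of "fst p" "- snd p"] by (simp add: el_def el'_def split_beta)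
  define Nm where "Nm p = \<lfloor>el p * el' p\<rfloor>" for p
  have Nm: "el p * el' p = of_int (Nm p)" for p
    unfolding Nm_def using mem_norm_int[OF mem_el[of p]] by (metis Ints_cases floor_of_int)
  define S where "S = approx_set w"
  have infS: "infinite S" unfolding S_def using rational_iff_finite_approx_set irrational by blast
  define B where "B = \<lceil>1 + (w - w')\<rceil>"
  have Spos: "snd p > 0" if "p \<in> S" for p using that by (auto simp: S_def approx_set_def)
  have bound: "\<bar>Nm p\<bar> \<le> B" if "p \<in> S" for p
  proof -
    obtain h k where p: "p = (h, k)" by (cases p)
    have k: "k > 0" and hk: "\<bar>w - of_int h / of_int k\<bar> < 1 / (of_int k)\<^sup>2"
      using that by (auto simp: S_def approx_set_def p)
    have "\<bar>el p\<bar> = of_int k * \<bar>w - of_int h / of_int k\<bar>"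
    proof -
      have "el p = of_int k * (of_int h / of_int k - w)" using k by (simp add: el_def p field_simps)
      then show ?thesis using k by (simp add: abs_mult abs_minus_commute)
    qed
    also have "\<dots> \<le> of_int k * (1 / (of_int k)\<^sup>2)" using k hk by (intro mult_left_mono) auto
    also have "\<dots> = 1 / of_int k" using k by (simp add: power2_eq_square)
    finally have e: "\<bar>el p\<bar> \<le> 1 / of_int k" .
    \<comment> \<open>The conjugate is at most of order \<open>k\<close>, which the bound
      \<open>1 / k\<close> on \<open>el p\<close> compensates in the product.\<close>
    have "el' p = el p + of_int k * (w - w')" by (simp add: el_def el'_def p algebra_simps)
    then have "\<bar>el' p\<bar> \<le> \<bar>el p\<bar> + of_int k * (w - w')"
      using k conj_less by (simp add: abs_triangle_ineq[THEN order_trans])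
    also have "\<dots> \<le> of_int k * (1 + (w - w'))"
    proof -
      have "1 / of_int k \<le> (of_int k :: real)"
        using k by (simp add: divide_le_eq) (use one_le_power[of "of_int k :: real" 2] in \<open>simp add: power2_eq_square\<close>)
      then show ?thesis using e by (simp add: algebra_simps)
    qed
    finally have e': "\<bar>el' p\<bar> \<le> of_int k * (1 + (w - w'))" .
    have "\<bar>el p * el' p\<bar> \<le> (1 / of_int k) * (of_int k * (1 + (w - w')))"
      unfolding abs_mult by (intro mult_mono e e') (use k in auto)
    also have "\<dots> = 1 + (w - w')" using k by simp
    finally have "of_int \<bar>Nm p\<bar> \<le> (of_int B :: real)" unfolding Nm B_def by linarith
    then show ?thesis by (simp only: of_int_le_iff)
  qed
  define cls where "cls p = (Nm p, fst p mod Nm p, snd p mod Nm p)" for p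
  have el_nz: "el p \<noteq> 0" if "p \<in> S" for p
  proof
    assume "el p = 0"
    obtain h k where p: "p = (h, k)" by (cases p)
    show False using \<open>el p = 0\<close> coords_eq[of h "-k" 0 0] Spos[OF that] by (simp add: p el_def)
  qed
  have Nm_nz: "Nm p \<noteq> 0" if "p \<in> S" for p
    using mem_norm_ge_1[OF mem_el el_nz[OF that]] unfolding Nm by auto
  have "cls ` S \<subseteq> {-B..B} \<times> {-B..B} \<times> {-B..B}"
  proof (rule image_subsetI)
    fix p assume S: "p \<in> S"
    have "- B \<le> c mod Nm p \<and> c mod Nm p \<le> B" for c
      using abs_mod_less[OF Nm_nz[OF S], of c] bound[OF S] by linarith
    then show "cls p \<in> {-B..B} \<times> {-B..B} \<times> {-B..B}"
      using bound[OF S] by (auto simp: cls_def abs_le_iff)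
  qed
  then have "finite (cls ` S)" by (rule finite_subset) simp
  with infS obtain p where p: "p \<in> S" "infinite {q \<in> S. cls q = cls p}"
    using pigeonhole_infinite by blast
  then have "\<not> {q \<in> S. cls q = cls p} \<subseteq> {p}" using finite_subset by blast
  then obtain q where q: "q \<in> S" "cls q = cls p" "q \<noteq> p" by blast
  define N where "N = Nm p"
  have N: "Nm p = N" "Nm q = N" "fst q mod N = fst p mod N" "snd q mod N = snd p mod N"
    using q(2) by (auto simp: cls_def N_def)
  have Nz: "N \<noteq> 0" using Nm_nz p N by blast
  obtain i where i: "fst q = fst p + N * i" using N(3) by (metis mod_eqE)
  obtain j where j: "snd q = snd p + N * j" using N(4) by (metis mod_eqE)
  define g where "g = of_int i - of_int j * w"
  define g' where "g' = of_int i - of_int j * w'"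
  have g: "mem g g'" unfolding g_def g'_def using memI[of i "-j"] by simp
  have elq: "el q = el p + of_int N * g" "el' q = el' p + of_int N * g'"
    using i j by (simp_all add: el_def el'_def g_def g'_def split_beta algebra_simps)
  have nz: "el p \<noteq> 0" "el' p \<noteq> 0" "el q \<noteq> 0" "el' q \<noteq> 0"
    using el_nz p q mem_eq_0_iff mem_el by blast+
  \<comment> \<open>This is the quotient \<open>el q / el p\<close>: since
    \<open>N = el p * el' p\<close>, dividing \<open>N * g\<close> by \<open>el p\<close> leaves
    \<open>g * el' p\<close>, which lies in the order.\<close>
  define u where "u = 1 + g * el' p"
  define u' where "u' = 1 + g' * el p"
  have mu: "mem u u'" unfolding u_def u'_def
    by (intro mem_add mem_1 mem_mult g mem_conj[OF mem_el])
  have u: "el p * u = el q" "el' p * u' = el' q"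
  proof -
    have "el p * u = el p + (el p * el' p) * g" by (simp add: u_def algebra_simps)
    then show "el p * u = el q" unfolding Nm N elq by simp
    have "el' p * u' = el' p + (el p * el' p) * g'" by (simp add: u'_def algebra_simps)
    then show "el' p * u' = el' q" unfolding Nm N elq by simp
  qed
  have "of_int N * (u * u') = el p * u * (el' p * u')" using Nm[of p] N by (simp add: mult_ac)
  also have "\<dots> = of_int N" unfolding u using Nm[of q] N by simp
  finally have "u * u' = 1" using Nz by simp
  with mu have unit_u: "unit u u'" by (simp add: unit_def)
  \<comment> \<open>\<open>u = 1\<close> would make the two approximations equal, and
    \<open>u = -1\<close> would give their positive denominators opposite signs.\<close>
  have ne: "u \<noteq> 1 \<and> u \<noteq> -1"
  proof (intro conjI notI)
    assume "u = 1"
    then have "el q = el p" using u by simp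
    then show False using coords_eq[of "fst q" "- snd q" "fst p" "- snd p"] q(3)
      by (simp add: el_def split_beta prod_eq_iff)
  next
    assume "u = -1"
    then have "el q = - el p" using u by simp
    then have "snd q = - snd p" using coords_eq[of "fst q" "- snd q" "- fst p" "snd p"]
      by (simp add: el_def split_beta)
    then show False using Spos[OF p(1)] Spos[OF q(1)] by simp
  qed
  obtain u'' where a: "unit \<bar>u\<bar> u''" using unit_abs[OF unit_u] .
  show ?thesis
  proof (cases "\<bar>u\<bar> > 1")
    case True then show ?thesis using a by blast
  next
    case False
    then have "\<bar>u\<bar> < 1" "\<bar>u\<bar> > 0" using ne unit_nz[OF unit_u] by auto
    then have "1 / \<bar>u\<bar> > 1" by simp
    then show ?thesis using unit_inverse[OF a] by blast
  qed
qed

text \<open>A unit greater than 1 has a conjugate of absolute value below 1, so the units between 1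
  and a given one are finite in number.\<close>

lemma ex_min_unit: "\<exists>e e'. unit e e' \<and> e > 1 \<and> (\<forall>u u'. unit u u' \<and> u > 1 \<longrightarrow> e \<le> u)"
proof -
  obtain v v' where v: "unit v v'" "v > 1" using ex_unit_gt_1 by blast
  define S where "S = {(u, u'). unit u u' \<and> 1 < u \<and> u \<le> v}"
  have "S \<subseteq> {(x, x'). mem x x' \<and> \<bar>x\<bar> \<le> v \<and> \<bar>x'\<bar> \<le> v}"
  proof clarify
    fix u u' assume S: "(u, u') \<in> S"
    then have u: "mem u u'" "\<bar>u\<bar> * \<bar>u'\<bar> = 1" "1 < u" "u \<le> v" by (auto simp: S_def unit_def abs_mult)
    then have "1 * \<bar>u'\<bar> \<le> \<bar>u\<bar> * \<bar>u'\<bar>" by (intro mult_right_mono) auto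
    then show "mem u u' \<and> \<bar>u\<bar> \<le> v \<and> \<bar>u'\<bar> \<le> v" using u v by auto
  qed
  then have fin: "finite S" using finite_mem_bounded finite_subset by blast
  have ne: "S \<noteq> {}" using v by (auto simp: S_def)
  from fin ne obtain p where p: "p \<in> S" "\<forall>q\<in>S. fst p \<le> fst q"
    using ex_min_if_finite[of "fst ` S"] by (force simp: not_less)
  have "fst p \<le> u" if "unit u u'" "u > 1" for u u'
    using that p v by (cases "u \<le> v") (fastforce simp: S_def)+
  then show ?thesis using p by (intro exI[of _ "fst p"] exI[of _ "snd p"]) (auto simp: S_def)
qed

end

section \<open>Planar lattices\<close>

lemma vec2_eq_iff: "(x :: real^2) = y \<longleftrightarrow> x $ 1 = y $ 1 \<and> x $ 2 = y $ 2"
  by (simp add: vec_eq_iff forall_2)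

lemma inner_vec2: "(x :: real^2) \<bullet> y = x $ 1 * y $ 1 + x $ 2 * y $ 2"
  by (simp add: inner_vec_def sum_2)

lemma norm_vec2_le_iff:
  "norm (x :: real^2) \<le> norm (y :: real^2) \<longleftrightarrow> (x $ 1)\<^sup>2 + (x $ 2)\<^sup>2 \<le> (y $ 1)\<^sup>2 + (y $ 2)\<^sup>2"
  by (simp add: norm_vec_def L2_set_def sum_2)

lemma vec2_matrix_mult:
  "(vector [vector [a, b], vector [c, d]] :: real^2^2) *v x = vector [a * x $ 1 + b * x $ 2, c * x $ 1 + d * x $ 2]"
  by (simp add: vec2_eq_iff matrix_vector_mult_def sum_2)

lemma rotation_matrix_vec2:
  assumes "a\<^sup>2 + b\<^sup>2 = 1"
  shows "rotation_matrix (vector [vector [a, b], vector [- b, a]] :: real^2^2)"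
proof -
  have "orthogonal_matrix (vector [vector [a, b], vector [- b, a]] :: real^2^2)"
    using assms
    by (simp add: orthogonal_matrix vec_eq_iff forall_2 matrix_matrix_mult_def transpose_def mat_def sum_2
        power2_eq_square algebra_simps)
  then show ?thesis using assms by (simp add: rotation_matrix_def det_2 power2_eq_square)
qed

lemma basis_vec2:
  fixes u v :: "real^2"
  assumes "u $ 1 * v $ 2 - u $ 2 * v $ 1 \<noteq> 0"
  shows "span {u, v} = UNIV" "independent {u, v}" "u \<noteq> v"
proof -
  define e where "e = u $ 1 * v $ 2 - u $ 2 * v $ 1"
  have e: "e \<noteq> 0" using assms by (simp add: e_def)
  have "x \<in> span {u, v}" for x
  proof -
    \<comment> \<open>Cramer's rule, with \<open>e\<close> the determinant.\<close>
    have "x $ 1 * e = (x $ 1 * v $ 2 - x $ 2 * v $ 1) * u $ 1 + (u $ 1 * x $ 2 - u $ 2 * x $ 1) * v $ 1"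
         "x $ 2 * e = (x $ 1 * v $ 2 - x $ 2 * v $ 1) * u $ 2 + (u $ 1 * x $ 2 - u $ 2 * x $ 1) * v $ 2"
      by (simp_all add: e_def algebra_simps)
    then have "x = ((x $ 1 * v $ 2 - x $ 2 * v $ 1) / e) *\<^sub>R u + ((u $ 1 * x $ 2 - u $ 2 * x $ 1) / e) *\<^sub>R v"
      using e by (simp add: vec2_eq_iff flip: add_divide_distrib) (simp add: eq_divide_eq)
    moreover have "\<dots> \<in> span {u, v}" by (intro span_add span_scale span_base) auto
    ultimately show ?thesis by simp
  qed
  then show sp: "span {u, v} = UNIV" by blast
  show "u \<noteq> v" using assms by auto
  show "independent {u, v}"
    using card_le_dim_spanning[of "{u, v}" UNIV] sp card_insert_le_m1[of 2 "{v}" u] by simp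
qed

lemma not_well_rounded_if_unique_minimal:
  assumes "minimal_vectors L \<subseteq> {v, - v}"
  shows "\<not> well_rounded L"
proof
  assume "well_rounded L"
  moreover have "minimal_vectors L \<subseteq> span {v}"
    using assms by (auto intro: span_base span_neg)
  ultimately have "dim (UNIV :: (real^2) set) \<le> card {v}"
    unfolding well_rounded_def
    by (metis dim_le_card finite.emptyI finite.insertI span_minimal subspace_span)
  then show False by simp
qed

lemma well_roundedI:
  fixes u v :: "real^2"
  assumes "u \<in> minimal_vectors L" "v \<in> minimal_vectors L" "u $ 1 * v $ 2 - u $ 2 * v $ 1 \<noteq> 0"
  shows "well_rounded L"
  using basis_vec2(1)[OF assms(3)] span_mono[of "{u, v}" "minimal_vectors L"] assms(1,2)
  by (auto simp: well_rounded_def)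

lemma planar_latticeI:
  fixes u v :: "real^2"
  assumes "L = {of_int m *\<^sub>R u + of_int n *\<^sub>R v | m n. True}" "u $ 1 * v $ 2 - u $ 2 * v $ 1 \<noteq> 0"
  shows "planar_lattice L"
  using basis_vec2[OF assms(2)] assms(1) unfolding planar_lattice_def by blast

lemma int_lattice_iff: "x \<in> int_lattice \<longleftrightarrow> (\<exists>a b :: int. x = vector [of_int a, of_int b])"
  by (auto simp: int_lattice_def forall_2 vec2_eq_iff elim!: Ints_cases)

lemma planar_int_lattice: "planar_lattice int_lattice"
proof (rule planar_latticeI)
  show "int_lattice = {of_int m *\<^sub>R (vector [1, 0] :: real^2) + of_int n *\<^sub>R vector [0, 1] | m n. True}"
    by (auto simp: int_lattice_iff vec2_eq_iff)
qed simp

section \<open>Similarity classes of lattices\<close>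

lemma similarity_int_lattice_refl: "(int_lattice, int_lattice) \<in> similarity"
proof -
  have "rotation_matrix (mat 1 :: real^2^2)" by (simp add: rotation_matrix_def orthogonal_matrix_id)
  then show ?thesis unfolding similarity_def
    by (auto simp: planar_int_lattice intro!: exI[of _ 1] exI[of _ "mat 1"])
qed

lemma similarity_sym:
  assumes "(L, M) \<in> similarity"
  shows "(M, L) \<in> similarity"
proof -
  obtain c Q where c: "c > 0" "rotation_matrix Q" "M = (\<lambda>x. c *\<^sub>R (Q *v x)) ` L"
    and LM: "planar_lattice L" "planar_lattice M" using assms by (auto simp: similarity_def)
  have Q: "transpose Q ** Q = mat 1" using c by (simp add: rotation_matrix_def orthogonal_matrix)
  have "rotation_matrix (transpose Q)" using c
    by (simp add: rotation_matrix_def orthogonal_matrix_transpose det_transpose)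
  moreover have "(1 / c) *\<^sub>R (transpose Q *v (c *\<^sub>R (Q *v x))) = x" for x
    using c(1) Q by (simp add: matrix_vector_mult_scaleR matrix_vector_mul_assoc)
  then have "L = (\<lambda>x. (1 / c) *\<^sub>R (transpose Q *v x)) ` M"
    unfolding c(3) image_image by simp
  moreover have "1 / c > 0" using c by simp
  ultimately show ?thesis using LM unfolding similarity_def by blast
qed

lemma similarity_trans:
  assumes "(L, M) \<in> similarity" "(M, N) \<in> similarity"
  shows "(L, N) \<in> similarity"
proof -
  obtain c Q where c: "c > 0" "rotation_matrix Q" "M = (\<lambda>x. c *\<^sub>R (Q *v x)) ` L"
    using assms by (auto simp: similarity_def)
  obtain d R where d: "d > 0" "rotation_matrix R" "N = (\<lambda>x. d *\<^sub>R (R *v x)) ` M"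
    using assms by (auto simp: similarity_def)
  have "rotation_matrix (R ** Q)" using c d
    by (simp add: rotation_matrix_def orthogonal_matrix_mul det_mul)
  moreover have "N = (\<lambda>x. (d * c) *\<^sub>R ((R ** Q) *v x)) ` L"
    unfolding c(3) d(3) image_image
    by (simp add: matrix_vector_mult_scaleR matrix_vector_mul_assoc)
  moreover have "d * c > 0" using c d by simp
  moreover have "planar_lattice L" "planar_lattice N" using assms by (auto simp: similarity_def)
  ultimately show ?thesis unfolding similarity_def by blast
qed

lemma similarity_class_eq:
  assumes "(L, M) \<in> similarity"
  shows "similarity `` {L} = similarity `` {M}"
  using assms similarity_sym similarity_trans by blast

text \<open>Nonemptiness guarantees that the class of \<open>N\<close> really occurs; otherwise the
  quotient would be empty.\<close>

lemma wr_classes_eqI: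
  assumes "\<And>M. M \<in> well_rounded_twists L \<Longrightarrow> (M, N) \<in> similarity" "well_rounded_twists L \<noteq> {}"
  shows "wr_classes L = {similarity `` {N}}"
  using assms similarity_class_eq unfolding wr_classes_def quotient_def by fastforce

lemma wr_classes_eqD:
  assumes "wr_classes L = {similarity `` {int_lattice}}" "M \<in> well_rounded_twists L"
  shows "(int_lattice, M) \<in> similarity"
proof -
  have "similarity `` {M} \<in> wr_classes L" using assms(2) unfolding wr_classes_def by (rule quotientI)
  then have "similarity `` {M} = similarity `` {int_lattice}" using assms(1) by simp
  then have "int_lattice \<in> similarity `` {M}" using similarity_int_lattice_refl by simp
  then have "(M, int_lattice) \<in> similarity" by simp
  then show ?thesis by (rule similarity_sym)
qed

text \<open>\<open>v\<close> is \<open>u\<close> turned by a right angle in one of the two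
  directions. The rotation that puts \<open>u\<close> on the first axis, followed by scaling by
  \<open>1 / r\<close>, maps \<open>u\<close> and \<open>v\<close> to the standard basis up to the
  sign \<open>g\<close> of the second vector, and \<open>int_lattice\<close> is invariant under that
  sign.\<close>

lemma square_lattice:
  fixes u v :: "real^2"
  assumes L: "L = {of_int m *\<^sub>R u + of_int n *\<^sub>R v | m n. True}"
    and orth: "u \<bullet> v = 0" and eq: "u \<bullet> u = v \<bullet> v" and nz: "u \<noteq> 0"
  shows "(L, int_lattice) \<in> similarity" "well_rounded L"
proof -
  define r where "r = norm u"
  have "r\<^sup>2 = u \<bullet> u" by (simp add: r_def power2_norm_eq_inner)
  then have r: "r > 0" "r\<^sup>2 = (u $ 1)\<^sup>2 + (u $ 2)\<^sup>2"
    using nz by (simp_all add: r_def inner_vec2 power2_eq_square)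
  define e where "e = u $ 1 * v $ 2 - u $ 2 * v $ 1"
  have o: "u $ 1 * v $ 1 + u $ 2 * v $ 2 = 0" using orth by (simp add: inner_vec2)
  have rv: "r\<^sup>2 = (v $ 1)\<^sup>2 + (v $ 2)\<^sup>2" using r eq by (simp add: inner_vec2 power2_eq_square)
  \<comment> \<open>Lagrange's identity; with orthogonality it determines the determinant up to
    sign.\<close>
  have "e\<^sup>2 = ((u $ 1)\<^sup>2 + (u $ 2)\<^sup>2) * ((v $ 1)\<^sup>2 + (v $ 2)\<^sup>2) - (u $ 1 * v $ 1 + u $ 2 * v $ 2)\<^sup>2"
    by (simp add: e_def power2_eq_square algebra_simps)
  then have "e\<^sup>2 = (r\<^sup>2)\<^sup>2" unfolding o using r rv by (simp add: power2_eq_square)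
  then have "e = r\<^sup>2 \<or> e = - r\<^sup>2" by (simp only: power2_eq_iff)
  then obtain g :: int where g: "g = 1 \<or> g = -1" "e = of_int g * r\<^sup>2"
    using that[of 1] that[of "-1"] by auto
  have enz: "e \<noteq> 0" using g r by auto
  have "r\<^sup>2 * v $ 1 = (u $ 1 * v $ 1 + u $ 2 * v $ 2) * u $ 1 - e * u $ 2"
       "r\<^sup>2 * v $ 2 = (u $ 1 * v $ 1 + u $ 2 * v $ 2) * u $ 2 + e * u $ 1"
    unfolding r(2) e_def by (simp_all add: power2_eq_square algebra_simps)
  then have "r\<^sup>2 * v $ 1 = r\<^sup>2 * (- of_int g * u $ 2)" "r\<^sup>2 * v $ 2 = r\<^sup>2 * (of_int g * u $ 1)"
    unfolding o g(2) by (simp_all add: mult_ac)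
  then have v: "v $ 1 = - of_int g * u $ 2" "v $ 2 = of_int g * u $ 1"
    using mult_left_cancel[of "r\<^sup>2"] r(1) by (metis less_irrefl power_not_zero)+
  have pl: "planar_lattice L" using planar_latticeI[OF L] enz by (simp add: e_def)
  define Q :: "real^2^2" where "Q = vector [vector [u $ 1 / r, u $ 2 / r], vector [- (u $ 2 / r), u $ 1 / r]]"
  have Q: "rotation_matrix Q" unfolding Q_def
    by (rule rotation_matrix_vec2) (use r(1) in \<open>simp add: power_divide flip: add_divide_distrib r(2)\<close>)
  have img: "(1 / r) *\<^sub>R (Q *v (of_int m *\<^sub>R u + of_int n *\<^sub>R v)) = vector [of_int m, of_int (g * n)]" for m n
  proof -
    let ?x = "of_int m *\<^sub>R u + of_int n *\<^sub>R v"
    have "u $ 1 * ?x $ 1 + u $ 2 * ?x $ 2 = of_int m * r\<^sup>2"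
      unfolding r(2) by (simp add: v power2_eq_square algebra_simps)
    moreover have "u $ 1 * ?x $ 2 - u $ 2 * ?x $ 1 = of_int (g * n) * r\<^sup>2"
      unfolding r(2) by (simp add: v power2_eq_square algebra_simps)
    moreover have "(1 / r) *\<^sub>R (Q *v x) = vector [(u $ 1 * x $ 1 + u $ 2 * x $ 2) / r\<^sup>2, (u $ 1 * x $ 2 - u $ 2 * x $ 1) / r\<^sup>2]" for x
      unfolding Q_def vec2_matrix_mult by (simp add: vec2_eq_iff power2_eq_square add_divide_distrib diff_divide_distrib)
    ultimately show ?thesis using r(1) by simp
  qed
  have "int_lattice = (\<lambda>x. (1 / r) *\<^sub>R (Q *v x)) ` L"
  proof (intro equalityI subsetI)
    fix x assume "x \<in> int_lattice"
    then obtain a b :: int where x: "x = vector [of_int a, of_int b]" by (auto simp: int_lattice_iff)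
    have b: "g * (g * b) = b" using g by auto
    have "x = (1 / r) *\<^sub>R (Q *v (of_int a *\<^sub>R u + of_int (g * b) *\<^sub>R v))"
      unfolding img b x ..
    then show "x \<in> (\<lambda>x. (1 / r) *\<^sub>R (Q *v x)) ` L" unfolding L by blast
  next
    fix x assume "x \<in> (\<lambda>x. (1 / r) *\<^sub>R (Q *v x)) ` L"
    then show "x \<in> int_lattice" unfolding L int_lattice_iff using img by blast
  qed
  moreover have "1 / r > 0" using r by simp
  ultimately show "(L, int_lattice) \<in> similarity"
    unfolding similarity_def using pl planar_int_lattice Q by blast
  \<comment> \<open>On this lattice the squared length is \<open>r^2\<close> times the form
    \<open>m^2 + n^2\<close>, so no nonzero vector is shorter than \<open>u\<close> and
    \<open>v\<close>.\<close>
  have nrm: "x \<bullet> x = (of_int (m\<^sup>2 + n\<^sup>2)) * r\<^sup>2" if "x = of_int m *\<^sub>R u + of_int n *\<^sub>R v" for x m n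
    unfolding that using orth eq
    by (simp add: inner_add inner_commute[of v u] r_def power2_norm_eq_inner power2_eq_square[of "of_int _"] algebra_simps)
  have ge: "x \<bullet> x \<ge> r\<^sup>2" if xL: "x \<in> L - {0}" for x
  proof -
    obtain m n where x: "x = of_int m *\<^sub>R u + of_int n *\<^sub>R v" using xL L by blast
    then have "m \<noteq> 0 \<or> n \<noteq> 0" using xL by auto
    then have "m\<^sup>2 + n\<^sup>2 > 0" by (auto simp: sum_power2_gt_zero_iff)
    then have "of_int (m\<^sup>2 + n\<^sup>2) \<ge> (1 :: real)" by linarith
    then have "1 * r\<^sup>2 \<le> of_int (m\<^sup>2 + n\<^sup>2) * r\<^sup>2" by (intro mult_right_mono) auto
    then show ?thesis using nrm[OF x] by simp
  qed
  have uv: "u \<in> L - {0}" "v \<in> L - {0}"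
  proof -
    have "u \<in> L" unfolding L by (rule CollectI, rule exI[of _ 1], rule exI[of _ 0]) simp
    moreover have "v \<in> L" unfolding L by (rule CollectI, rule exI[of _ 0], rule exI[of _ 1]) simp
    moreover have "v \<noteq> 0" using nz eq by auto
    ultimately show "u \<in> L - {0}" "v \<in> L - {0}" using nz by auto
  qed
  have uu: "u \<bullet> u = r\<^sup>2" by (simp add: r_def power2_norm_eq_inner)
  then have vv: "v \<bullet> v = r\<^sup>2" using eq by simp
  have "norm u \<le> norm y" "norm v \<le> norm y" if "y \<in> L - {0}" for y
    unfolding norm_le uu vv by (rule ge[OF that])+
  then have "u \<in> minimal_vectors L" "v \<in> minimal_vectors L"
    unfolding minimal_vectors_def using uv by blast+
  then show "well_rounded L" by (rule well_roundedI) (use enz in \<open>simp add: e_def\<close>)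
qed

text \<open>The minimal vectors of \<open>int_lattice\<close> are the two standard basis vectors and
  their negatives. A similarity preserves minimality and orthogonality, so two minimal vectors that
  are not equal up to sign come from different axes.\<close>

lemma similar_to_int_lattice_minimal_basis:
  assumes sim: "(int_lattice, L) \<in> similarity"
    and u: "u \<in> minimal_vectors L" and v: "v \<in> minimal_vectors L" and uv: "v \<noteq> u" "v \<noteq> - u"
  shows "u \<bullet> v = 0" "\<And>x. x \<in> L \<Longrightarrow> \<exists>a b :: int. x = of_int a *\<^sub>R u + of_int b *\<^sub>R v"
proof -
  obtain c Q where c: "c > 0" "rotation_matrix Q" and L: "L = (\<lambda>x. c *\<^sub>R (Q *v x)) ` int_lattice"
    using sim by (auto simp: similarity_def)
  define F where "F x = c *\<^sub>R (Q *v x)" for x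
  have LF: "L = F ` int_lattice" unfolding L F_def ..
  have lin: "F (a *\<^sub>R x + b *\<^sub>R y) = a *\<^sub>R F x + b *\<^sub>R F y" for a b x y
    by (simp add: F_def matrix_vector_right_distrib matrix_vector_mult_scaleR scaleR_right_distrib mult.commute)
  have "orthogonal_transformation ((*v) Q)" using c
    by (simp add: rotation_matrix_def orthogonal_transformation_matrix)
  then have "(Q *v x) \<bullet> (Q *v y) = x \<bullet> y" for x y by (simp add: orthogonal_transformation_def)
  then have inn: "F x \<bullet> F y = c\<^sup>2 * (x \<bullet> y)" for x y by (simp add: F_def power2_eq_square)
  have F0: "F x = 0 \<longleftrightarrow> x = 0" for x
    using inn[of x x] c(1) by (metis inner_eq_zero_iff mult_eq_0_iff power_not_zero less_irrefl)
  have min: "\<exists>e1 e2 :: int. x = F (vector [of_int e1, of_int e2]) \<and>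
     (e1, e2) \<in> {(1,0), (-1,0), (0,1), (0,-1)}" if "x \<in> minimal_vectors L" for x
  proof -
    have "x \<in> L" using that by (simp add: minimal_vectors_def)
    then obtain e1 e2 :: int where e: "x = F (vector [of_int e1, of_int e2])"
      unfolding LF by (auto simp: int_lattice_iff)
    have nz: "x \<noteq> 0" using that by (simp add: minimal_vectors_def)
    \<comment> \<open>A nonzero lattice point of length 1; its image bounds the length of every
      minimal vector.\<close>
    define y :: "real^2" where "y = vector [of_int 1, of_int 0]"
    have "y \<in> int_lattice" unfolding y_def int_lattice_iff by blast
    moreover have "y \<noteq> 0" by (simp add: y_def vec2_eq_iff)
    ultimately have "F y \<in> L - {0}" using F0 by (simp add: LF)
    then have "x \<bullet> x \<le> F y \<bullet> F y" using that by (simp add: minimal_vectors_def norm_le)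
    then have "c\<^sup>2 * of_int (e1\<^sup>2 + e2\<^sup>2) \<le> c\<^sup>2 * 1"
      unfolding e inn by (simp add: y_def inner_vec2 power2_eq_square)
    then have "of_int (e1\<^sup>2 + e2\<^sup>2) \<le> (1 :: real)" using c(1) by (simp only: mult_le_cancel_left_pos zero_less_power)
    then have le: "e1\<^sup>2 + e2\<^sup>2 \<le> 1" by linarith
    then have "e1\<^sup>2 \<le> 1" "e2\<^sup>2 \<le> 1" using zero_le_power2[of e1] zero_le_power2[of e2] by linarith+
    then have "\<bar>e1\<bar> \<le> 1" "\<bar>e2\<bar> \<le> 1" by (simp_all only: abs_square_le_1)
    then have "e1 \<in> {-1, 0, 1}" "e2 \<in> {-1, 0, 1}" by auto
    moreover have "(e1, e2) \<noteq> (0, 0)"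
    proof
      assume "(e1, e2) = (0, 0)"
      then have "vector [of_int e1, of_int e2] = (0 :: real^2)" by (simp add: vec2_eq_iff)
      then show False using e nz F0 by simp
    qed
    ultimately have "(e1, e2) \<in> {(1,0), (-1,0), (0,1), (0,-1)}" using le by auto
    then show ?thesis using e by blast
  qed
  obtain e1 e2 :: int where e: "u = F (vector [of_int e1, of_int e2])"
    "(e1, e2) \<in> {(1,0), (-1,0), (0,1), (0,-1)}" using min[OF u] by blast
  obtain f1 f2 :: int where f: "v = F (vector [of_int f1, of_int f2])"
    "(f1, f2) \<in> {(1,0), (-1,0), (0,1), (0,-1)}" using min[OF v] by blast
  have "vector [of_int (- e1), of_int (- e2)] = - (vector [of_int e1, of_int e2] :: real^2)"
    by (simp add: vec2_eq_iff)
  then have neg: "F (vector [of_int (- e1), of_int (- e2)]) = - u"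
    unfolding e(1) using lin[of "-1" "vector [of_int e1, of_int e2]" 0 0] by simp
  have "\<not> (f1 = e1 \<and> f2 = e2)" using uv(1) e(1) f(1) by metis
  moreover have "\<not> (f1 = - e1 \<and> f2 = - e2)" using uv(2) neg f(1) by metis
  ultimately have cases: "e1 = 0 \<and> f2 = 0 \<and> (e2 = 1 \<or> e2 = -1) \<and> (f1 = 1 \<or> f1 = -1) \<or>
    e2 = 0 \<and> f1 = 0 \<and> (e1 = 1 \<or> e1 = -1) \<and> (f2 = 1 \<or> f2 = -1)"
    using e(2) f(2) by auto
  then show "u \<bullet> v = 0" unfolding e(1) f(1) inn by (auto simp: inner_vec2)
  fix x assume "x \<in> L"
  then obtain a b :: int where x: "x = F (vector [of_int a, of_int b])"
    unfolding LF by (auto simp: int_lattice_iff)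
  \<comment> \<open>The preimages of \<open>u\<close> and \<open>v\<close> are orthonormal, so the
    coefficients are inner products.\<close>
  have "vector [of_int a, of_int b] = of_int (a * e1 + b * e2) *\<^sub>R (vector [of_int e1, of_int e2] :: real^2) +
      of_int (a * f1 + b * f2) *\<^sub>R vector [of_int f1, of_int f2]"
    using cases by (auto simp: vec2_eq_iff)
  then have "x = of_int (a * e1 + b * e2) *\<^sub>R u + of_int (a * f1 + b * f2) *\<^sub>R v"
    unfolding x e(1) f(1) by (simp only: lin)
  then show "\<exists>a b :: int. x = of_int a *\<^sub>R u + of_int b *\<^sub>R v" by blast
qed

section \<open>Twists of the lattice of a quadratic order\<close>

context quadratic_order
begin

definition lat :: "(real^2) set" where
  "lat = {vector [x, x'] | x x'. mem x x'}"

lemma twist_lat: "twist \<alpha> lat = {vector [\<alpha> * x, x' / \<alpha>] | x x'. mem x x'}"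
  unfolding twist_def lat_def image_def by (fastforce simp: vec2_matrix_mult)

lemma minimal_vectors_twist_iff:
  assumes "\<alpha> > 0" "mem x x'"
  shows "vector [\<alpha> * x, x' / \<alpha>] \<in> minimal_vectors (twist \<alpha> lat) \<longleftrightarrow>
    x \<noteq> 0 \<and> (\<forall>z z'. mem z z' \<longrightarrow> z \<noteq> 0 \<longrightarrow>
      (\<alpha> * x)\<^sup>2 + (x' / \<alpha>)\<^sup>2 \<le> (\<alpha> * z)\<^sup>2 + (z' / \<alpha>)\<^sup>2)"
proof -
  define V :: "real \<Rightarrow> real \<Rightarrow> real^2" where "V z z' = vector [\<alpha> * z, z' / \<alpha>]" for z z'
  have nz: "V z z' \<noteq> 0 \<longleftrightarrow> z \<noteq> 0" if "mem z z'" for z z'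
    using assms(1) mem_eq_0_iff[OF that] by (auto simp: V_def vec2_eq_iff)
  have le: "norm (V x x') \<le> norm (V z z') \<longleftrightarrow> (\<alpha> * x)\<^sup>2 + (x' / \<alpha>)\<^sup>2 \<le> (\<alpha> * z)\<^sup>2 + (z' / \<alpha>)\<^sup>2" for z z'
    by (simp add: norm_vec2_le_iff V_def)
  have L: "twist \<alpha> lat = {V z z' | z z'. mem z z'}" by (simp add: twist_lat V_def)
  have "V x x' \<in> minimal_vectors (twist \<alpha> lat) \<longleftrightarrow>
    V x x' \<noteq> 0 \<and> (\<forall>z z'. mem z z' \<longrightarrow> V z z' \<noteq> 0 \<longrightarrow> norm (V x x') \<le> norm (V z z'))"
    unfolding minimal_vectors_def L using assms(2) by blast
  then show ?thesis unfolding V_def[symmetric] using nz assms(2) le by simp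
qed

text \<open>The arithmetic-geometric mean inequality together with
  \<open>\<bar>z * z'\<bar> \<ge> 1\<close>; equality forces
  \<open>\<bar>z\<bar> = \<bar>z'\<bar> = 1\<close>. Hence only the vectors of \<open>1\<close> and
  \<open>-1\<close> are minimal without a twist.\<close>

lemma sum_squares_ge_2:
  assumes "mem z z'" "z \<noteq> 0"
  shows "z\<^sup>2 + z'\<^sup>2 \<ge> 2" and "z \<noteq> 1 \<Longrightarrow> z \<noteq> - 1 \<Longrightarrow> z\<^sup>2 + z'\<^sup>2 > 2"
proof -
  have eq: "z\<^sup>2 + z'\<^sup>2 = (\<bar>z\<bar> - \<bar>z'\<bar>)\<^sup>2 + 2 * \<bar>z * z'\<bar>"
    by (simp add: power2_eq_square abs_mult algebra_simps)
  have N: "\<bar>z * z'\<bar> \<ge> 1" using mem_norm_ge_1[OF assms] .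
  show ge: "z\<^sup>2 + z'\<^sup>2 \<ge> 2" using N zero_le_power2[of "\<bar>z\<bar> - \<bar>z'\<bar>"] eq by linarith
  show "z\<^sup>2 + z'\<^sup>2 > 2" if "z \<noteq> 1" "z \<noteq> - 1"
  proof (rule ccontr)
    assume "\<not> z\<^sup>2 + z'\<^sup>2 > 2"
    then have "(\<bar>z\<bar> - \<bar>z'\<bar>)\<^sup>2 = 0" "\<bar>z * z'\<bar> = 1"
      using N zero_le_power2[of "\<bar>z\<bar> - \<bar>z'\<bar>"] eq by linarith+
    then have "\<bar>z\<bar> * \<bar>z\<bar> = 1" by (simp add: abs_mult)
    then show False using that by (simp add: square_eq_1_iff)
  qed
qed

text \<open>With \<open>\<beta> = \<alpha>\<^sup>4\<close>, the vector of \<open>1\<close> stays minimal in the twist by \<open>\<alpha> \<ge> 1\<close> as long as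
  \<open>\<beta> (1 - z\<^sup>2) \<le> z'\<^sup>2 - 1\<close> for all \<open>z\<close> with \<open>\<bar>z\<bar> < 1\<close>; equality is attained at the first \<open>\<beta>\<close>
  at which another vector becomes as short.\<close>

lemma ex_twist_one_minimal:
  obtains \<beta> y y' where "\<beta> > 0" "mem y y'" "y \<notin> \<rat>" "\<beta> * y\<^sup>2 + y'\<^sup>2 = \<beta> + 1"
    "\<forall>z z'. mem z z' \<longrightarrow> z \<noteq> 0 \<longrightarrow> \<beta> + 1 \<le> \<beta> * z\<^sup>2 + z'\<^sup>2"
proof -
  \<comment> \<open>Only these elements can catch up with \<open>1\<close> as \<open>\<beta>\<close>
    grows.\<close>
  define S where "S = {(z, z'). mem z z' \<and> z \<noteq> 0 \<and> \<bar>z\<bar> < 1}"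
  \<comment> \<open>The value of \<open>\<beta>\<close> at which the vector of \<open>z\<close>
    becomes as short as that of \<open>1\<close>, solved from
    \<open>\<beta> * z^2 + z'^2 = \<beta> + 1\<close>.\<close>
  define f where "f = (\<lambda>(z :: real, z' :: real). (z'\<^sup>2 - 1) / (1 - z\<^sup>2))"
  have sq: "0 < z\<^sup>2 \<and> z\<^sup>2 < 1" if "z \<noteq> 0" "\<bar>z\<bar> < 1" for z :: real
    using that by (simp add: abs_square_less_1)
  have fin: "finite {p \<in> S. f p \<le> C}" for C
  proof (rule finite_subset[OF _ finite_mem_bounded[of "\<bar>C\<bar> + 1"]])
    show "{p \<in> S. f p \<le> C} \<subseteq> {(x, x'). mem x x' \<and> \<bar>x\<bar> \<le> \<bar>C\<bar> + 1 \<and> \<bar>x'\<bar> \<le> \<bar>C\<bar> + 1}"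
    proof clarify
      fix z z' assume z: "(z, z') \<in> S" "f (z, z') \<le> C"
      then have zS: "mem z z'" "z \<noteq> 0" "\<bar>z\<bar> < 1" by (auto simp: S_def)
      have "z'\<^sup>2 - 1 \<le> C * (1 - z\<^sup>2)" using z(2) sq[OF zS(2,3)] by (simp add: f_def divide_le_eq)
      also have "\<dots> \<le> \<bar>C\<bar> * 1" using sq[OF zS(2,3)] by (intro mult_mono) auto
      also have "\<dots> + 1 \<le> (\<bar>C\<bar> + 1)\<^sup>2" by (simp add: power2_eq_square algebra_simps)
      finally have "z'\<^sup>2 \<le> (\<bar>C\<bar> + 1)\<^sup>2" by simp
      then have "\<bar>z'\<bar> \<le> \<bar>C\<bar> + 1" using abs_le_square_iff[of z' "\<bar>C\<bar> + 1"] by simp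
      then show "mem z z' \<and> \<bar>z\<bar> \<le> \<bar>C\<bar> + 1 \<and> \<bar>z'\<bar> \<le> \<bar>C\<bar> + 1" using zS by auto
    qed
  qed
  \<comment> \<open>The fractional part of \<open>w\<close> shows that \<open>S\<close> is
    inhabited.\<close>
  have "w - of_int \<lfloor>w\<rfloor> \<noteq> 0" using irrational by (metis Rats_of_int eq_iff_diff_eq_0)
  moreover have "0 \<le> w - of_int \<lfloor>w\<rfloor>" "w - of_int \<lfloor>w\<rfloor> < 1" by linarith+
  moreover have "mem (w - of_int \<lfloor>w\<rfloor>) (w' - of_int \<lfloor>w\<rfloor>)" using mem_diff[OF mem_gen mem_int] .
  ultimately have "(w - of_int \<lfloor>w\<rfloor>, w' - of_int \<lfloor>w\<rfloor>) \<in> S" by (simp add: S_def)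
  then obtain p0 where p0: "p0 \<in> S" by blast
  \<comment> \<open>\<open>S\<close> is infinite in general, but its sublevel sets for
    \<open>f\<close> are finite, so a minimum of \<open>f\<close> is found in one of them.\<close>
  define A where "A = {q \<in> S. f q \<le> f p0}"
  define p where "p = arg_min_on f A"
  have "p0 \<in> A" "finite A" using fin p0 by (simp_all add: A_def)
  then have "p \<in> A" "\<forall>q\<in>A. f p \<le> f q" using arg_min_if_finite[of A f] by (auto simp add: p_def not_less simp del: split_paired_All)
  then have p: "p \<in> S" "f p \<le> f p0" "\<forall>q \<in> {q \<in> S. f q \<le> f p0}. f p \<le> f q"
    by (auto simp: A_def)
  then have min: "f p \<le> f q" if "q \<in> S" for q using p(2,3) that by (cases "f q \<le> f p0") (blast, linarith)
  obtain y y' where py: "p = (y, y')" by (cases p)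
  have y: "mem y y'" "y \<noteq> 0" "\<bar>y\<bar> < 1" using p(1) by (auto simp: S_def py)
  define \<beta> where "\<beta> = f p"
  have prod: "z\<^sup>2 * z'\<^sup>2 \<ge> 1" if "mem z z'" "z \<noteq> 0" for z z'
    using power_mono[OF mem_norm_ge_1[OF that], of 2] by (simp add: power_mult_distrib)
  have \<beta>: "\<beta> * (1 - y\<^sup>2) = y'\<^sup>2 - 1" using sq[OF y(2,3)] by (simp add: \<beta>_def f_def py)
  have \<beta>1: "\<beta> > 1"
  proof -
    have a: "0 < y\<^sup>2" "y\<^sup>2 < 1" using sq[OF y(2,3)] by auto
    have "1 - y\<^sup>2 < y'\<^sup>2 - 1"
      using sum_squares_ge_2(2)[OF y(1,2)] y(3) by force
    then show ?thesis using a by (simp add: \<beta>_def f_def py)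
  qed
  show ?thesis
  proof (rule that[of \<beta> y y'])
    show "\<beta> > 0" using \<beta>1 by simp
    show "y \<notin> \<rat>"
    proof
      assume "y \<in> \<rat>"
      then have "y \<in> \<int>" using mem_rational y(1) by blast
      then show False using y Ints_nonzero_abs_ge1 by fastforce
    qed
    show "\<beta> * y\<^sup>2 + y'\<^sup>2 = \<beta> + 1" using \<beta> by (simp add: algebra_simps)
    show "\<forall>z z'. mem z z' \<longrightarrow> z \<noteq> 0 \<longrightarrow> \<beta> + 1 \<le> \<beta> * z\<^sup>2 + z'\<^sup>2"
    proof (intro allI impI)
      fix z z' assume z: "mem z z'" "z \<noteq> 0"
      show "\<beta> + 1 \<le> \<beta> * z\<^sup>2 + z'\<^sup>2"
      proof (cases "\<bar>z\<bar> < 1")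
        case True
        then have "\<beta> \<le> f (z, z')" using min z by (simp add: S_def \<beta>_def)
        then have "\<beta> * (1 - z\<^sup>2) \<le> z'\<^sup>2 - 1" using sq[OF z(2) True] by (simp add: f_def le_divide_eq)
        then show ?thesis by (simp add: algebra_simps)
      next
        case False
        then have "z\<^sup>2 \<ge> 1" using abs_square_less_1[of z] by simp
        then have "1 * (z\<^sup>2 - 1) \<le> \<beta> * (z\<^sup>2 - 1)" using \<beta>1 by (intro mult_right_mono) auto
        then show ?thesis using sum_squares_ge_2(1)[OF z] by (simp add: algebra_simps)
      qed
    qed
  qed (fact y(1))
qed

text \<open>Where \<open>1\<close> and \<open>y\<close> are both minimal, similarity to the square
  lattice makes their vectors an orthogonal basis, so \<open>\<beta> * y + y' = 0\<close>. With
  equal lengths this gives \<open>\<beta> * y^2 = 1\<close>, hence \<open>y * y' = - 1\<close>;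
  expressing the vector of \<open>w\<close> in this basis gives the last claim.\<close>

lemma ex_norm_minus_1_generator:
  assumes "wr_classes lat = {similarity `` {int_lattice}}"
  obtains y y' where "mem y y'" "y * y' = - 1" "\<exists>a b :: int. w = of_int a + of_int b * y"
proof -
  obtain \<beta> y y' where \<beta>: "\<beta> > 0" and y: "mem y y'" "y \<notin> \<rat>" "\<beta> * y\<^sup>2 + y'\<^sup>2 = \<beta> + 1"
    and min: "\<forall>z z'. mem z z' \<longrightarrow> z \<noteq> 0 \<longrightarrow> \<beta> + 1 \<le> \<beta> * z\<^sup>2 + z'\<^sup>2"
    using ex_twist_one_minimal .
  define \<alpha> where "\<alpha> = root 4 \<beta>"
  have \<alpha>: "\<alpha> > 0" "\<alpha> ^ 4 = \<beta>" using \<beta> by (simp_all add: \<alpha>_def)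
  have q: "(\<alpha> * z)\<^sup>2 + (z' / \<alpha>)\<^sup>2 = (\<beta> * z\<^sup>2 + z'\<^sup>2) / \<alpha>\<^sup>2" for z z'
    using \<alpha>(1) unfolding \<alpha>(2)[symmetric] by (simp add: field_simps power2_eq_square eval_nat_numeral)
  define M where "M = twist \<alpha> lat"
  define u :: "real^2" where "u = vector [\<alpha> * 1, 1 / \<alpha>]"
  define v :: "real^2" where "v = vector [\<alpha> * y, y' / \<alpha>]"
  have u: "u \<in> minimal_vectors M" and v: "v \<in> minimal_vectors M"
    unfolding u_def v_def M_def minimal_vectors_twist_iff[OF \<alpha>(1) mem_1] minimal_vectors_twist_iff[OF \<alpha>(1) y(1)] q
    using y min by (auto intro!: divide_right_mono)
  \<comment> \<open>Distinct conjugates make the vectors of \<open>1\<close> and \<open>y\<close>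
    linearly independent.\<close>
  have ne: "y \<noteq> y'"
  proof
    obtain a b :: int where ab: "y = of_int a + of_int b * w" "y' = of_int a + of_int b * w'"
      using y(1) by (auto simp: mem_def)
    assume "y = y'"
    then have "b = 0" using conj_less unfolding ab by simp
    then show False using y(2) ab by simp
  qed
  have "u $ 1 * v $ 2 - u $ 2 * v $ 1 \<noteq> 0" using \<alpha>(1) ne by (simp add: u_def v_def)
  then have "well_rounded M" using well_roundedI u v by blast
  then have "M \<in> well_rounded_twists lat" using \<alpha>(1) unfolding well_rounded_twists_def M_def by blast
  then have sim: "(int_lattice, M) \<in> similarity" using wr_classes_eqD assms by blast
  have "y \<noteq> 1" "y \<noteq> -1" using y(2) by auto
  then have "\<alpha> * y \<noteq> \<alpha> * 1" "\<alpha> * y \<noteq> \<alpha> * - 1" using \<alpha>(1) by (simp_all only: mult_cancel_left) auto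
  then have uv: "v \<noteq> u" "v \<noteq> - u" by (auto simp: u_def v_def vec2_eq_iff)
  have "u \<bullet> v = 0" using similar_to_int_lattice_minimal_basis(1)[OF sim u v uv] .
  then have "\<alpha>\<^sup>2 * y + y' / \<alpha>\<^sup>2 = 0" by (simp add: u_def v_def inner_vec2 power2_eq_square)
  then have "\<beta> * y + y' = 0" using \<alpha>(1) unfolding \<alpha>(2)[symmetric]
    by (simp add: field_simps eval_nat_numeral)
  then have y': "y' = - \<beta> * y" by simp
  have "(\<beta> + 1) * (\<beta> * y\<^sup>2) = (\<beta> + 1) * 1" using y(3) unfolding y' by (simp add: power2_eq_square algebra_simps)
  then have "\<beta> * y\<^sup>2 = 1" using \<beta> by (simp only: mult_cancel_left) auto
  then have N: "y * y' = - 1" unfolding y' by (simp add: power2_eq_square mult_ac)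
  have "vector [\<alpha> * w, w' / \<alpha>] \<in> M" unfolding M_def twist_lat using mem_gen by blast
  then obtain a b :: int where "vector [\<alpha> * w, w' / \<alpha>] = of_int a *\<^sub>R u + of_int b *\<^sub>R v"
    using similar_to_int_lattice_minimal_basis(2)[OF sim u v uv] by blast
  then have "\<alpha> * w = \<alpha> * (of_int a + of_int b * y)" by (simp add: vec2_eq_iff u_def v_def algebra_simps)
  then have "w = of_int a + of_int b * y" using \<alpha>(1) by simp
  then show ?thesis using that y(1) N by blast
qed

end

section \<open>Orders generated by a unit of norm -1\<close>

locale negative_pell_order = quadratic_order +
  assumes norm_minus_1: "n = - 1" and w_gt_1: "w > 1"
begin

lemma w': "w' = - 1 / w"
  using norm w_gt_1 by (simp add: norm_minus_1 field_simps)

lemma unit_w: "unit w w'"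
  using mem_gen norm by (simp add: unit_def norm_minus_1)

text \<open>Write \<open>u = a + b * w\<close>. From \<open>\<bar>u'\<bar> < 1 < u\<close> follows
  \<open>b \<ge> 1\<close>, and since \<open>w'\<close> is negative, \<open>a \<le> -1\<close> would
  push \<open>u'\<close> down to at most \<open>-1\<close>.\<close>

lemma unit_ge_w: "w \<le> u" if u: "unit u u'" "u > 1"
proof -
  obtain a b :: int where ab: "u = of_int a + of_int b * w" "u' = of_int a + of_int b * w'"
    using unit_mem[OF u(1)] by (auto simp: mem_def)
  have "\<bar>u\<bar> * \<bar>u'\<bar> = 1" using u(1) by (simp add: unit_def abs_mult)
  then have "\<bar>u'\<bar> = 1 / u" using u(2) by (simp add: field_simps)
  then have u': "\<bar>u'\<bar> < 1" using u(2) by simp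
  have "of_int b * (w - w') = u - u'" unfolding ab by (simp add: algebra_simps)
  also have "\<dots> > 0" using u' u by linarith
  finally have "b > 0" using conj_less by (simp add: zero_less_mult_iff)
  then have b: "b \<ge> 1" by simp
  have "a > -1"
  proof (rule ccontr)
    assume "\<not> a > -1"
    then have "of_int a \<le> (-1 :: real)" by simp
    moreover have "of_int b * w' \<le> 0" using b w_gt_1 by (simp add: w' mult_nonneg_nonpos)
    ultimately show False using u' unfolding ab by linarith
  qed
  then have a: "of_int a \<ge> (0 :: real)" by simp
  have "1 * w \<le> of_int b * w" using b w_gt_1 by (intro mult_right_mono) auto
  then show ?thesis using a unfolding ab by linarith
qed

text \<open>Up to the factor \<open>w\<close>, the left side is the form for
  \<open>\<beta> = 1 / w^2\<close>; there \<open>1, w\<close> is an orthogonal basis of vectors of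
  equal length.\<close>

lemma form_at_square_twist:
  "(of_int a + of_int b * w)\<^sup>2 / w + w * (of_int a + of_int b * w')\<^sup>2 = (of_int a ^ 2 + of_int b ^ 2) * (w + 1 / w)"
  using w_gt_1 by (simp add: w' field_simps power2_eq_square)

text \<open>The first bound is \<open>a^2 + b^2 \<ge> 1\<close> in the square form. The second is
  the same inequality for \<open>z * w\<close>, since multiplication by \<open>w\<close> carries one
  end of the interval to the other.\<close>

lemma norm_form_bounds:
  assumes "mem z z'" "z \<noteq> 0"
  shows "1 / w\<^sup>2 * z\<^sup>2 + z'\<^sup>2 \<ge> 1 / w\<^sup>2 + 1" and "w\<^sup>2 * z\<^sup>2 + z'\<^sup>2 \<ge> w\<^sup>2 + 1"
proof -
  have *: "y\<^sup>2 / w + w * y'\<^sup>2 \<ge> w + 1 / w" if y: "mem y y'" "y \<noteq> 0" for y y'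
  proof -
    obtain a b :: int where ab: "y = of_int a + of_int b * w" "y' = of_int a + of_int b * w'"
      using y(1) by (auto simp: mem_def)
    then have "a \<noteq> 0 \<or> b \<noteq> 0" using y(2) by auto
    then have "a\<^sup>2 + b\<^sup>2 > 0" by (auto simp: sum_power2_gt_zero_iff)
    then have "of_int (a\<^sup>2 + b\<^sup>2) \<ge> (1 :: real)" by linarith
    then have "1 * (w + 1 / w) \<le> of_int (a\<^sup>2 + b\<^sup>2) * (w + 1 / w)"
      using w_gt_1 by (intro mult_right_mono) auto
    then show ?thesis unfolding ab form_at_square_twist by simp
  qed
  have "1 / w\<^sup>2 * z\<^sup>2 + z'\<^sup>2 = (z\<^sup>2 / w + w * z'\<^sup>2) / w" "1 / w\<^sup>2 + 1 = (w + 1 / w) / w"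
    using w_gt_1 by (simp_all add: field_simps power2_eq_square)
  then show "1 / w\<^sup>2 * z\<^sup>2 + z'\<^sup>2 \<ge> 1 / w\<^sup>2 + 1"
    using divide_right_mono[OF *[OF assms], of w] w_gt_1 by simp
  have "mem (z * w) (z' * w')" "z * w \<noteq> 0" using mem_mult[OF assms(1) mem_gen] assms w_gt_1 by auto
  from *[OF this] have "w + 1 / w \<le> (w\<^sup>2 * z\<^sup>2 + z'\<^sup>2) / w"
    using w_gt_1 by (simp add: w' field_simps power2_eq_square)
  then have "(w + 1 / w) * w \<le> (w\<^sup>2 * z\<^sup>2 + z'\<^sup>2)" using w_gt_1 by (simp only: pos_le_divide_eq)
  moreover have "(w + 1 / w) * w = w\<^sup>2 + 1" using w_gt_1 by (simp add: field_simps power2_eq_square)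
  ultimately show "w\<^sup>2 * z\<^sup>2 + z'\<^sup>2 \<ge> w\<^sup>2 + 1" by simp
qed

text \<open>The difference of the two sides is affine in \<open>\<gamma>\<close>, nonnegative at the end points of the
  interval and positive at \<open>\<gamma> = 1\<close>.\<close>

lemma one_strictly_minimal:
  assumes z: "mem z z'" "z \<noteq> 0" "z \<noteq> 1" "z \<noteq> -1" and \<gamma>: "1 / w\<^sup>2 < \<gamma>" "\<gamma> < w\<^sup>2"
  shows "\<gamma> * z\<^sup>2 + z'\<^sup>2 > \<gamma> + 1"
proof -
  define p where "p = z\<^sup>2 - 1"
  define q where "q = z'\<^sup>2 - 1"
  have b: "1 / w\<^sup>2 * p + q \<ge> 0" "w\<^sup>2 * p + q \<ge> 0" "p + q > 0"
    using norm_form_bounds[OF z(1,2)] sum_squares_ge_2(2)[OF z]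
    by (simp_all add: p_def q_def algebra_simps diff_divide_distrib)
  have "\<gamma> * p + q > 0"
  proof (cases "p \<ge> 0")
    case True
    show ?thesis
    proof (cases "p = 0")
      case False
      then have "1 / w\<^sup>2 * p < \<gamma> * p" using True \<gamma> by (intro mult_strict_right_mono) auto
      then show ?thesis using b by linarith
    qed (use b in simp)
  next
    case False
    then have "w\<^sup>2 * p < \<gamma> * p" using \<gamma> by (intro mult_strict_right_mono_neg) auto
    then show ?thesis using b by linarith
  qed
  then show ?thesis by (simp add: p_def q_def algebra_simps)
qed

text \<open>A factor \<open>w\<close> in \<open>e\<close> multiplies
  \<open>(\<alpha> * e) ^ 4\<close> by \<open>w ^ 4\<close>, which is the ratio of the end points
  \<open>w^2\<close> and \<open>1 / w^2\<close>, so a suitable power of \<open>w\<close> lands in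
  the half-open interval.\<close>

lemma ex_unit_scaling:
  assumes "\<alpha> > 0"
  obtains e e' where "unit e e'" "e > 0" "1 / w\<^sup>2 \<le> (\<alpha> * e) ^ 4" "(\<alpha> * e) ^ 4 < w\<^sup>2"
proof -
  \<comment> \<open>The added \<open>1 / 2\<close> rounds to the nearest integer, so that the
    remaining logarithm lies between \<open>- 1 / 2\<close> and \<open>1 / 2\<close>.\<close>
  define k where "k = \<lfloor>log w \<alpha> + 1 / 2\<rfloor>"
  define e where "e = w powi (- k)"
  have e: "unit e (w' powi (- k))" "e > 0"
    using unit_powi[OF unit_w, of "- k"] w_gt_1 by (simp_all add: e_def)
  have "log w (\<alpha> * e) = log w \<alpha> - of_int k"
  proof -
    have "e = w powr of_int (- k)"
      using w_gt_1 powr_real_of_int'[of w "- k"] by (simp add: e_def)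
    then have "log w e = of_int (- k)" using w_gt_1 by (simp only: log_powr_cancel)
    then show ?thesis using assms e w_gt_1 by (simp add: log_mult)
  qed
  then have l: "- 1 / 2 \<le> log w (\<alpha> * e)" "log w (\<alpha> * e) < 1 / 2"
    unfolding k_def by linarith+
  have "log w ((\<alpha> * e) ^ 4) = 4 * log w (\<alpha> * e)" using assms e w_gt_1 by (simp add: log_nat_power)
  then have "- 2 \<le> log w ((\<alpha> * e) ^ 4)" "log w ((\<alpha> * e) ^ 4) < 2" using l by linarith+
  moreover have "(\<alpha> * e) ^ 4 > 0" using assms e by simp
  ultimately have "w powr (- 2) \<le> (\<alpha> * e) ^ 4" "(\<alpha> * e) ^ 4 < w powr 2"
    using w_gt_1 by (simp_all add: le_log_iff log_less_iff)
  then have "1 / w\<^sup>2 \<le> (\<alpha> * e) ^ 4" "(\<alpha> * e) ^ 4 < w\<^sup>2"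
    using w_gt_1 by (simp_all add: powr_minus_divide)
  then show ?thesis using that e by blast
qed

text \<open>As \<open>e\<close> is a unit, \<open>e\<close> and \<open>e * w\<close> again form a
  basis of the order; the assumption on \<open>\<alpha> * e\<close> makes their vectors orthogonal
  and equally long.\<close>

lemma square_twist:
  assumes \<alpha>: "\<alpha> > 0" and e: "unit e e'" "(\<alpha> * e) ^ 4 = 1 / w\<^sup>2"
  shows "(twist \<alpha> lat, int_lattice) \<in> similarity" "well_rounded (twist \<alpha> lat)"
proof -
  define r where "r = 1 / e"
  define r' where "r' = 1 / e'"
  have r: "unit r r'" unfolding r_def r'_def using unit_inverse e by blast
  have er: "e * r = 1" "e' * r' = 1" using unit_nz[OF e(1)] by (auto simp: r_def r'_def)
  define u :: "real^2" where "u = vector [\<alpha> * e, e' / \<alpha>]"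
  define v :: "real^2" where "v = vector [\<alpha> * (e * w), e' * w' / \<alpha>]"
  have L: "twist \<alpha> lat = {of_int a *\<^sub>R u + of_int b *\<^sub>R v | a b. True}"
  proof (intro equalityI subsetI)
    fix x assume "x \<in> twist \<alpha> lat"
    then obtain z z' where z: "x = vector [\<alpha> * z, z' / \<alpha>]" "mem z z'" unfolding twist_lat by blast
    obtain a b :: int where ab: "r * z = of_int a + of_int b * w" "r' * z' = of_int a + of_int b * w'"
      using mem_mult[OF unit_mem[OF r] z(2)] by (auto simp: mem_def)
    have "z = e * (r * z)" "z' = e' * (r' * z')" using er by (simp_all flip: mult.assoc)
    then have zz: "z = e * (of_int a + of_int b * w)" "z' = e' * (of_int a + of_int b * w')"
      using ab by simp_all
    have "x = of_int a *\<^sub>R u + of_int b *\<^sub>R v"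
      unfolding z(1) zz using \<alpha> by (simp add: vec2_eq_iff u_def v_def field_simps)
    then show "x \<in> {of_int a *\<^sub>R u + of_int b *\<^sub>R v | a b. True}" by blast
  next
    fix x assume "x \<in> {of_int a *\<^sub>R u + of_int b *\<^sub>R v | a b. True}"
    then obtain a b :: int where x: "x = of_int a *\<^sub>R u + of_int b *\<^sub>R v" by blast
    have "mem (e * (of_int a + of_int b * w)) (e' * (of_int a + of_int b * w'))"
      using mem_mult[OF unit_mem[OF e(1)] memI] .
    moreover have "x = vector [\<alpha> * (e * (of_int a + of_int b * w)), e' * (of_int a + of_int b * w') / \<alpha>]"
      unfolding x using \<alpha> by (simp add: vec2_eq_iff u_def v_def field_simps)
    ultimately show "x \<in> twist \<alpha> lat" unfolding twist_lat by blast
  qed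
  have nz: "\<alpha> \<noteq> 0" "e \<noteq> 0" "w \<noteq> 0" "w > 0" using \<alpha> unit_nz[OF e(1)] w_gt_1 by auto
  have "((\<alpha> * e)\<^sup>2)\<^sup>2 = (1 / w)\<^sup>2" using e(2) by (simp add: power_divide flip: power_mult)
  then have g: "(\<alpha> * e)\<^sup>2 = 1 / w" by (rule power2_eq_imp_eq) (use nz in auto)
  have "\<bar>e * e'\<bar>\<^sup>2 = 1" using e(1) unfolding unit_def by (metis one_power2)
  then have "(e' / \<alpha>)\<^sup>2 * (\<alpha> * e)\<^sup>2 = 1" using nz by (simp add: power_mult_distrib power_divide mult_ac)
  then have g': "(e' / \<alpha>)\<^sup>2 = w" unfolding g using nz by simp
  have "u \<bullet> v = (\<alpha> * e)\<^sup>2 * w + (e' / \<alpha>)\<^sup>2 * w'"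
    by (simp add: inner_vec2 u_def v_def power2_eq_square)
  then have o: "u \<bullet> v = 0" unfolding g g' w' using nz by simp
  have "u \<bullet> u = (\<alpha> * e)\<^sup>2 + (e' / \<alpha>)\<^sup>2" "v \<bullet> v = (\<alpha> * e)\<^sup>2 * w\<^sup>2 + (e' / \<alpha>)\<^sup>2 * w'\<^sup>2"
    by (simp_all add: inner_vec2 u_def v_def power2_eq_square)
  then have q: "u \<bullet> u = v \<bullet> v" unfolding g g' w' using nz by (simp add: power2_eq_square)
  have "u \<noteq> 0" using nz by (simp add: u_def vec2_eq_iff)
  from square_lattice[OF L o q this]
  show "(twist \<alpha> lat, int_lattice) \<in> similarity" "well_rounded (twist \<alpha> lat)" by auto
qed

text \<open>After rescaling by a unit, either the parameter is the left end point, where the twist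
  is square, or it is interior, where only the vectors of \<open>e\<close> and \<open>- e\<close>
  can be minimal and the twist is not well-rounded.\<close>

lemma well_rounded_twist_square:
  assumes \<alpha>: "\<alpha> > 0" and wr: "well_rounded (twist \<alpha> lat)"
  shows "(twist \<alpha> lat, int_lattice) \<in> similarity"
proof -
  obtain e e' where e: "unit e e'" "e > 0" "1 / w\<^sup>2 \<le> (\<alpha> * e) ^ 4" "(\<alpha> * e) ^ 4 < w\<^sup>2"
    using ex_unit_scaling[OF \<alpha>] .
  define \<gamma> where "\<gamma> = (\<alpha> * e) ^ 4"
  show ?thesis
  proof (cases "1 / w\<^sup>2 = \<gamma>")
    case True
    then show ?thesis using square_twist(1)[OF \<alpha> e(1)] by (simp add: \<gamma>_def)
  next
    case False
    then have \<gamma>: "1 / w\<^sup>2 < \<gamma>" "\<gamma> < w\<^sup>2" using e by (auto simp: \<gamma>_def)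
    have nz: "e \<noteq> 0" "e' \<noteq> 0" using unit_nz[OF e(1)] by auto
    have "\<bar>e * e'\<bar>\<^sup>2 = 1" using e(1) unfolding unit_def by (metis one_power2)
    then have ee: "e'\<^sup>2 = 1 / e\<^sup>2" using nz by (simp add: power_mult_distrib field_simps)
    \<comment> \<open>Dividing elements by \<open>e\<close> turns the form of the twist into the one
      with parameter \<open>\<gamma>\<close>, up to a constant; the role of \<open>e\<close> is then
      taken by \<open>1\<close>.\<close>
    have q: "(\<alpha> * (e * z))\<^sup>2 + (e' * z' / \<alpha>)\<^sup>2 = (\<gamma> * z\<^sup>2 + z'\<^sup>2) / (\<alpha> * e)\<^sup>2" for z z'
    proof -
      have "(e' * z' / \<alpha>)\<^sup>2 = z'\<^sup>2 / (\<alpha> * e)\<^sup>2" by (simp add: power_mult_distrib power_divide ee)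
      moreover have "(\<alpha> * (e * z))\<^sup>2 = \<gamma> * z\<^sup>2 / (\<alpha> * e)\<^sup>2"
        using \<alpha> nz by (simp add: \<gamma>_def power_mult_distrib eval_nat_numeral)
      ultimately show ?thesis by (simp add: add_divide_distrib)
    qed
    define v :: "real^2" where "v = vector [\<alpha> * e, e' / \<alpha>]"
    have "minimal_vectors (twist \<alpha> lat) \<subseteq> {v, - v}"
    proof
      fix x assume x: "x \<in> minimal_vectors (twist \<alpha> lat)"
      then have "x \<in> twist \<alpha> lat" by (simp add: minimal_vectors_def)
      then obtain z z' where z: "x = vector [\<alpha> * z, z' / \<alpha>]" "mem z z'" unfolding twist_lat by blast
      define y where "y = 1 / e * z"
      define y' where "y' = 1 / e' * z'"
      have y: "mem y y'" unfolding y_def y'_def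
        using mem_mult[OF unit_mem[OF unit_inverse[OF e(1)]] z(2)] .
      have zy: "z = e * y" "z' = e' * y'" using nz by (simp_all add: y_def y'_def)
      have min: "z \<noteq> 0" "(\<alpha> * z)\<^sup>2 + (z' / \<alpha>)\<^sup>2 \<le> (\<alpha> * e)\<^sup>2 + (e' / \<alpha>)\<^sup>2"
        using x minimal_vectors_twist_iff[OF \<alpha> z(2)] unit_mem[OF e(1)] nz unfolding z(1) by blast+
      have "(\<gamma> * y\<^sup>2 + y'\<^sup>2) / (\<alpha> * e)\<^sup>2 \<le> (\<gamma> + 1) / (\<alpha> * e)\<^sup>2"
        using min(2) q[of 1 1] unfolding zy q[of y y'] by simp
      then have "\<gamma> * y\<^sup>2 + y'\<^sup>2 \<le> \<gamma> + 1" using \<alpha> nz by (simp add: divide_le_cancel)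
      moreover have "y \<noteq> 0" using min(1) zy by auto
      ultimately have "y = 1 \<or> y = -1" using one_strictly_minimal[OF y _ _ _ \<gamma>] by force
      then have "y = 1 \<and> y' = 1 \<or> y = -1 \<and> y' = -1"
        using y mem_unique mem_1 mem_minus_1 by blast
      then show "x \<in> {v, - v}" unfolding z(1) zy v_def by (auto simp: vec2_eq_iff)
    qed
    then show ?thesis using wr not_well_rounded_if_unique_minimal by blast
  qed
qed

lemma wr_classes_lat: "wr_classes lat = {similarity `` {int_lattice}}"
proof (rule wr_classes_eqI)
  fix M assume "M \<in> well_rounded_twists lat"
  then show "(M, int_lattice) \<in> similarity"
    using well_rounded_twist_square by (auto simp: well_rounded_twists_def)
next
  \<comment> \<open>This twist is square with the unit \<open>e = 1\<close>, so at least one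
    well-rounded twist exists.\<close>
  have "root 4 (1 / w\<^sup>2) > 0" "(root 4 (1 / w\<^sup>2) * 1) ^ 4 = 1 / w\<^sup>2" using w_gt_1 by simp_all
  then show "well_rounded_twists lat \<noteq> {}"
    using square_twist(2)[OF _ unit_1] unfolding well_rounded_twists_def by blast
qed


end

section \<open>The ring of integers as a quadratic order\<close>

context quadratic_order
begin

text \<open>Since \<open>y = p + q * w\<close> generates the order, \<open>q\<close> is
  \<open>1\<close> or \<open>-1\<close>; absorbing this sign into \<open>p\<close>, the norm of
  \<open>y\<close> becomes the stated polynomial.\<close>

lemma ex_norm_minus_1_if_wr_classes:
  assumes "wr_classes lat = {similarity `` {int_lattice}}"
  shows "\<exists>p. p\<^sup>2 + p * t + n = - 1"
proof -
  obtain y y' where y: "mem y y'" "y * y' = - 1" "\<exists>a b :: int. w = of_int a + of_int b * y"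
    using ex_norm_minus_1_generator[OF assms] .
  then obtain a b p q :: int where ab: "w = of_int a + of_int b * y"
    and pq: "y = of_int p + of_int q * w" "y' = of_int p + of_int q * w'" by (auto simp: mem_def)
  have "of_int (a + b * p) + of_int (b * q) * w = of_int a + of_int b * y" by (simp add: pq algebra_simps)
  also have "\<dots> = of_int 0 + of_int 1 * w" by (simp flip: ab)
  finally have "b * q = 1" using coords_eq by blast
  then have "q dvd 1" by (metis dvd_triv_right)
  then have q: "q = 1 \<or> q = - 1" by auto
  have "- 1 = of_int (p * p) + of_int (p * q) * (w + w') + of_int (q * q) * (w * w')"
    unfolding y(2)[symmetric] pq by (simp add: algebra_simps)
  also have "\<dots> = of_int (p * p + p * q * t + q * q * n)" unfolding trace norm by simp
  finally have "p * p + p * q * t + q * q * n = - 1"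
    by (metis of_int_1 of_int_eq_iff of_int_minus)
  then have "(p * q)\<^sup>2 + (p * q) * t + n = - 1" using q by (auto simp: power2_eq_square)
  then show ?thesis by blast
qed

end

text \<open>The bridge to the field: \<open>1, w\<close> is an integral basis and the formal
  conjugation is the Galois conjugation, so results on orders transfer to
  \<open>field_lattice D\<close> and \<open>fundamental_unit D\<close>.\<close>

locale integer_basis = real_quadratic D + quadratic_order w w' t n
  for D :: int and w w' :: real and t n :: int +
  assumes mem_iff: "mem x x' \<longleftrightarrow> x \<in> ring_of_integers D \<and> x' = galois_conj D x"
begin

lemma field_lattice_eq: "field_lattice D = lat"
  unfolding field_lattice_def lat_def by (auto simp: mem_iff)

text \<open>The norms of two mutually inverse elements multiply to 1, and neither is below 1 in
  absolute value.\<close>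

lemma is_integral_unit_iff: "is_integral_unit D u \<longleftrightarrow> (\<exists>u'. unit u u')"
proof
  assume "is_integral_unit D u"
  then obtain v u' v' where uv: "mem u u'" "mem v v'" "u * v = 1"
    unfolding is_integral_unit_def by (auto simp: mem_iff)
  have "u' * v' = 1" using mem_mult[OF uv(1,2)] uv(3) mem_unique mem_1 by auto
  moreover have "(u * u') * (v * v') = (u * v) * (u' * v')" by (simp only: mult_ac)
  ultimately have "(u * u') * (v * v') = 1" using uv(3) by simp
  then have 1: "\<bar>u * u'\<bar> * \<bar>v * v'\<bar> = 1" by (metis abs_mult abs_one)
  have nz: "u \<noteq> 0" "v \<noteq> 0" using uv(3) by auto
  have ge: "\<bar>u * u'\<bar> \<ge> 1" "\<bar>v * v'\<bar> \<ge> 1" using mem_norm_ge_1 uv nz by blast+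
  then have "\<bar>u * u'\<bar> * 1 \<le> \<bar>u * u'\<bar> * \<bar>v * v'\<bar>" by (intro mult_left_mono) auto
  then have "\<bar>u * u'\<bar> = 1" using 1 ge by linarith
  then show "\<exists>u'. unit u u'" using uv(1) by (auto simp: unit_def)
next
  assume "\<exists>u'. unit u u'"
  then obtain u' where u: "unit u u'" by blast
  have "mem u u'" "mem (1 / u) (1 / u')" using unit_mem u unit_inverse[OF u] by blast+
  moreover have "u * (1 / u) = 1" using unit_nz[OF u] by simp
  ultimately show "is_integral_unit D u" unfolding is_integral_unit_def mem_iff by blast
qed

text \<open>Dividing \<open>u\<close> by the largest power of \<open>e\<close> not exceeding it
  leaves a unit that is at least 1 and below \<open>e\<close>; minimality makes it 1.\<close>

lemma unit_powi_if_minimal: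
  assumes e: "unit e e'" "e > 1" and min: "\<And>u u'. unit u u' \<Longrightarrow> u > 1 \<Longrightarrow> e \<le> u"
    and u: "unit u u'" "u > 0"
  shows "\<exists>k. u = e powi k"
proof -
  define k where "k = \<lfloor>log e u\<rfloor>"
  define v where "v = u * e powi (- k)"
  have v: "unit v (u' * e' powi (- k))" unfolding v_def using unit_mult u unit_powi e by blast
  have pos: "e powi (- k) > 0" using e by simp
  have "e powi (- k) = e powr of_int (- k)" using e powr_real_of_int'[of e "- k"] by simp
  then have "log e (e powi (- k)) = of_int (- k)" using e by (simp only: log_powr_cancel)
  then have l: "log e v = log e u - of_int k" unfolding v_def using u(2) pos e(2) by (simp add: log_mult)
  have vpos: "v > 0" using u(2) pos by (simp add: v_def)
  have "0 \<le> log e v" "log e v < 1" unfolding l k_def by linarith+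
  then have "1 \<le> v" "v < e" using vpos e(2) by (simp_all add: zero_le_log_cancel_iff log_less_iff)
  then have "v = 1" using min[OF v] by force
  then have "u = e powi k" using e(2) by (simp add: v_def power_int_minus field_simps)
  then show ?thesis by blast
qed

lemma fundamental_unit_eq:
  assumes e: "unit e e'" "e > 1" and min: "\<And>u u'. unit u u' \<Longrightarrow> u > 1 \<Longrightarrow> e \<le> u"
  shows "fundamental_unit D = e"
  unfolding fundamental_unit_def
proof (rule the_equality)
  have "{u. is_integral_unit D u} = {e powi n |n. True} \<union> {- (e powi n) |n. True}"
  proof (intro equalityI subsetI)
    fix u assume "u \<in> {u. is_integral_unit D u}"
    then obtain u' where u: "unit u u'" by (auto simp: is_integral_unit_iff)
    obtain u'' where "unit \<bar>u\<bar> u''" using unit_abs[OF u] .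
    moreover have "\<bar>u\<bar> > 0" using unit_nz[OF u] by simp
    ultimately obtain k where "\<bar>u\<bar> = e powi k" using unit_powi_if_minimal[OF e] min by blast
    then have "u = e powi k \<or> u = - (e powi k)" by linarith
    then show "u \<in> {e powi n |n. True} \<union> {- (e powi n) |n. True}" by blast
  next
    fix u assume "u \<in> {e powi n |n. True} \<union> {- (e powi n) |n. True}"
    then obtain k where "u = e powi k \<or> u = - (e powi k)" by blast
    then have "unit u (e' powi k) \<or> unit u (- (e' powi k))"
      using unit_powi[OF e(1), of k] unit_minus by blast
    then show "u \<in> {u. is_integral_unit D u}" by (auto simp: is_integral_unit_iff)
  qed
  then show "e > 1 \<and> {u. is_integral_unit D u} = {e powi n |n. True} \<union> {- (e powi n) |n. True}"
    using e by blast
next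
  \<comment> \<open>Uniqueness: \<open>e\<close> is a positive power of \<open>\<epsilon>\<close>,
    so \<open>\<epsilon> \<le> e\<close>, while minimality gives
    \<open>e \<le> \<epsilon>\<close>.\<close>
  fix \<epsilon> assume \<epsilon>: "\<epsilon> > 1 \<and> {u. is_integral_unit D u} = {\<epsilon> powi n |n. True} \<union> {- (\<epsilon> powi n) |n. True}"
  have "\<epsilon> \<in> {\<epsilon> powi n |n. True}" using power_int_1_right by (metis (mono_tags, lifting) mem_Collect_eq)
  then have "is_integral_unit D \<epsilon>" using \<epsilon> by blast
  then have 1: "e \<le> \<epsilon>" using min \<epsilon> by (auto simp: is_integral_unit_iff)
  have "e \<in> {u. is_integral_unit D u}" using e by (auto simp: is_integral_unit_iff)
  then obtain k where k: "e = \<epsilon> powi k \<or> e = - (\<epsilon> powi k)" using \<epsilon> by blast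
  have "\<epsilon> powi k > 0" using \<epsilon> by simp
  then have ek: "e = \<epsilon> powi k" using k e(2) by linarith
  have "k > 0"
  proof (rule ccontr)
    assume "\<not> k > 0"
    then have "\<epsilon> powi k = 1 / \<epsilon> ^ nat (- k)" by (simp add: power_int_def inverse_eq_divide power_divide)
    also have "\<dots> \<le> 1" using \<epsilon> by simp
    finally show False using ek e(2) by simp
  qed
  then have "\<epsilon> \<le> \<epsilon> powi k" using \<epsilon> self_le_power[of \<epsilon> "nat k"] by (simp add: power_int_def)
  then show "\<epsilon> = e" using 1 ek by simp
qed

text \<open>The definite description yields information only once some unit is known to satisfy it;
  the least unit above 1 does.\<close>

lemma fundamental_unit_integral: "fundamental_unit D > 1 \<and> fundamental_unit D \<in> ring_of_integers D"
proof -
  obtain e e' where e: "unit e e'" "e > 1" "\<forall>u u'. unit u u' \<and> u > 1 \<longrightarrow> e \<le> u"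
    using ex_min_unit by blast
  then have "fundamental_unit D = e" using fundamental_unit_eq by blast
  then show ?thesis using e unit_mem[OF e(1)] by (simp add: mem_iff)
qed

end

locale pell_basis = integer_basis + negative_pell_order
begin

lemma regulator_eq: "regulator D = ln w"
  using fundamental_unit_eq[OF unit_w w_gt_1 unit_ge_w] by (simp add: regulator_def)

lemma wr_classes_field_lattice: "wr_classes (field_lattice D) = {similarity `` {int_lattice}}"
  using wr_classes_lat by (simp add: field_lattice_eq)

end

section \<open>Explicit integral bases and the implications between the conditions\<close>

context real_quadratic
begin

lemma galois_conj_half:
  "galois_conj D (of_int m / 2 + of_int k / 2 * s) = of_int m / 2 - of_int k / 2 * s"
  by (rule galois_conj_eq) auto

text \<open>Changing \<open>c\<close> by an even number shifts the generator by an integer. The free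
  choice of \<open>c\<close> covers both the standard generator, \<open>c = 1\<close>, and the unit
  of norm \<open>-1\<close> when \<open>D - 4\<close> is a square.\<close>

lemma integer_basis_1_mod_4:
  assumes D: "D mod 4 = 1" and c: "odd c"
  shows "integer_basis D ((of_int c + s) / 2) ((of_int c - s) / 2) c ((c\<^sup>2 - D) div 4)"
proof -
  define w where "w = (of_int c + s) / 2"
  define w' where "w' = (of_int c - s) / 2"
  define n where "n = (c\<^sup>2 - D) div 4"
  have "4 dvd c\<^sup>2 - D * 1\<^sup>2" unfolding four_dvd_norm_iff using D c by simp
  then have n: "c\<^sup>2 - D = 4 * n" by (simp add: n_def)
  interpret quadratic_order w w' c n
  proof
    show "w + w' = of_int c" by (simp add: w_def w'_def field_simps)
    have "w * w' = (of_int c * of_int c - s * s) / 4" by (simp add: w_def w'_def algebra_simps)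
    then have "4 * (w * w') = of_int (c\<^sup>2 - D)" by (simp add: s_sq power2_eq_square)
    then show "w * w' = of_int n" unfolding n by simp
    show "w' < w" using s_pos by (simp add: w_def w'_def)
    have "s = 2 * w - of_int c" by (simp add: w_def field_simps)
    then show "w \<notin> \<rat>" using s_irrational by auto
  qed
  show ?thesis unfolding w_def[symmetric] w'_def[symmetric] n_def[symmetric]
  proof
    fix x x'
    show "mem x x' \<longleftrightarrow> x \<in> ring_of_integers D \<and> x' = galois_conj D x"
    proof
      assume "mem x x'"
      then obtain a b :: int where ab: "x = of_int a + of_int b * w" "x' = of_int a + of_int b * w'"
        by (auto simp: mem_def)
      have x: "x = of_int (2 * a + b * c) / 2 + of_int b / 2 * s" "x' = of_int (2 * a + b * c) / 2 - of_int b / 2 * s"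
        unfolding ab w_def w'_def by (simp_all add: field_simps)
      have "4 dvd (2 * a + b * c)\<^sup>2 - D * b\<^sup>2" unfolding four_dvd_norm_iff using D c by simp
      then show "x \<in> ring_of_integers D \<and> x' = galois_conj D x"
        unfolding ring_of_integers_iff using galois_conj_half x by metis
    next
      assume x: "x \<in> ring_of_integers D \<and> x' = galois_conj D x"
      then obtain m k where mk: "4 dvd m\<^sup>2 - D * k\<^sup>2" "x = of_int m / 2 + of_int k / 2 * s"
        unfolding ring_of_integers_iff by blast
      then have x': "x' = of_int m / 2 - of_int k / 2 * s" using x galois_conj_half by simp
      have "even (m - k * c)" using mk(1) c unfolding four_dvd_norm_iff using D by simp
      then obtain a where "m - k * c = 2 * a" by blast
      then have m: "m = 2 * a + k * c" by simp
      have "x = of_int a + of_int k * w" "x' = of_int a + of_int k * w'"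
        unfolding mk(2) x' m w_def w'_def by (simp_all add: field_simps)
      then show "mem x x'" by (simp only: memI)
    qed
  qed
qed

text \<open>Again the integer shift \<open>c\<close> covers the standard generator,
  \<open>c = 0\<close>, and the unit of norm \<open>-1\<close> when \<open>D - 1\<close> is a
  square.\<close>

lemma integer_basis_not_1_mod_4:
  assumes D: "D mod 4 \<noteq> 1"
  shows "integer_basis D (of_int c + s) (of_int c - s) (2 * c) (c\<^sup>2 - D)"
proof -
  define w where "w = of_int c + s"
  define w' where "w' = of_int c - s"
  interpret quadratic_order w w' "2 * c" "c\<^sup>2 - D"
  proof
    show "w + w' = of_int (2 * c)" by (simp add: w_def w'_def)
    show "w * w' = of_int (c\<^sup>2 - D)"
      by (simp add: w_def w'_def s_sq[symmetric] power2_eq_square algebra_simps)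
    show "w' < w" using s_pos by (simp add: w_def w'_def)
    have "s = w - of_int c" by (simp add: w_def)
    then show "w \<notin> \<rat>" using s_irrational by auto
  qed
  show ?thesis unfolding w_def[symmetric] w'_def[symmetric]
  proof
    fix x x'
    show "mem x x' \<longleftrightarrow> x \<in> ring_of_integers D \<and> x' = galois_conj D x"
    proof
      assume "mem x x'"
      then obtain a b :: int where ab: "x = of_int a + of_int b * w" "x' = of_int a + of_int b * w'"
        by (auto simp: mem_def)
      have x: "x = of_int (2 * (a + b * c)) / 2 + of_int (2 * b) / 2 * s"
        "x' = of_int (2 * (a + b * c)) / 2 - of_int (2 * b) / 2 * s"
        unfolding ab w_def w'_def by (simp_all add: field_simps)
      have "4 dvd (2 * (a + b * c))\<^sup>2 - D * (2 * b)\<^sup>2" unfolding four_dvd_norm_iff by simp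
      then show "x \<in> ring_of_integers D \<and> x' = galois_conj D x"
        unfolding ring_of_integers_iff using galois_conj_half x by metis
    next
      assume x: "x \<in> ring_of_integers D \<and> x' = galois_conj D x"
      then obtain m k where mk: "4 dvd m\<^sup>2 - D * k\<^sup>2" "x = of_int m / 2 + of_int k / 2 * s"
        unfolding ring_of_integers_iff by blast
      then have x': "x' = of_int m / 2 - of_int k / 2 * s" using x galois_conj_half by simp
      have "even m \<and> even k" using mk(1) unfolding four_dvd_norm_iff using D by simp
      then obtain a b where m: "m = 2 * a" "k = 2 * b" by blast
      have "x = of_int (a - b * c) + of_int b * w" "x' = of_int (a - b * c) + of_int b * w'"
        unfolding mk(2) x' m w_def w'_def by (simp_all add: field_simps)
      then show "mem x x'" by (simp only: memI)
    qed
  qed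
qed

text \<open>\<open>c\<close> is odd because \<open>D\<close> is, and \<open>D = c^2 + 4\<close>
  makes the norm \<open>-1\<close>. The absolute value ensures that the generator exceeds 1.\<close>

lemma pell_basis_1_mod_4:
  assumes D: "D mod 4 = 1" and c: "D = c\<^sup>2 + 4"
  shows "pell_basis D ((of_int \<bar>c\<bar> + s) / 2) ((of_int \<bar>c\<bar> - s) / 2) \<bar>c\<bar> (- 1)"
proof -
  have odd: "odd \<bar>c\<bar>"
  proof
    assume "even \<bar>c\<bar>"
    then have "even D" by (simp add: c)
    then show False using D by presburger
  qed
  have "\<bar>c\<bar> \<ge> 1" using odd by (cases "c = 0") auto
  then have "of_int \<bar>c\<bar> \<ge> (1 :: real)" by (simp only: of_int_1_le_iff)
  moreover have "s > 1" using D_gt_1 by (simp add: s_def)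
  ultimately have "(of_int \<bar>c\<bar> + s) / 2 > 1" by simp
  moreover have "(\<bar>c\<bar>\<^sup>2 - D) div 4 = - 1" by (simp add: c)
  ultimately show ?thesis
    using integer_basis_1_mod_4[OF D odd]
    by (simp add: pell_basis_def negative_pell_order_def negative_pell_order_axioms_def integer_basis_def)
qed

lemma pell_basis_not_1_mod_4:
  assumes D: "D mod 4 \<noteq> 1" and c: "D = c\<^sup>2 + 1"
  shows "pell_basis D (of_int \<bar>c\<bar> + s) (of_int \<bar>c\<bar> - s) (2 * \<bar>c\<bar>) (- 1)"
proof -
  have "s > 1" using D_gt_1 by (simp add: s_def)
  then have "of_int \<bar>c\<bar> + s > 1" by simp
  moreover have "\<bar>c\<bar>\<^sup>2 - D = - 1" by (simp add: c)
  ultimately show ?thesis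
    using integer_basis_not_1_mod_4[OF D, of "\<bar>c\<bar>"]
    by (simp add: pell_basis_def negative_pell_order_def negative_pell_order_axioms_def integer_basis_def)
qed

text \<open>An even \<open>c\<close> would give residue 1, and an odd one gives 2. This matches the
  residue in condition (ii) with the case split used elsewhere.\<close>

lemma sq_plus_1_mod_4:
  assumes "D = c\<^sup>2 + 1" "D mod 4 \<noteq> 1"
  shows "D mod 4 = 2"
proof -
  have "odd c"
  proof
    assume "even c"
    then have "4 dvd c\<^sup>2" by (auto elim!: evenE simp: power2_eq_square)
    then show False using assms by (simp add: mod_add_left_eq[symmetric] dvd_eq_mod_eq_0)
  qed
  then obtain k where "c = 2 * k + 1" by (rule oddE)
  then have "D = 2 + 4 * (k\<^sup>2 + k)" by (simp add: assms(1) power2_eq_square algebra_simps)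
  then show ?thesis by (simp only: mod_mult_self2) simp
qed

text \<open>The norm equation is read off for the standard generator: completing the square in
  \<open>p^2 + p + (1 - D) / 4 = - 1\<close> gives \<open>D = (2 * p + 1)^2 + 4\<close>, and
  otherwise \<open>p^2 - D = - 1\<close>.\<close>

lemma wr_classes_imp:
  assumes wr: "wr_classes (field_lattice D) = {similarity `` {int_lattice}}"
  shows "if D mod 4 = 1 then \<exists>c. D = c\<^sup>2 + 4 else \<exists>c. D = c\<^sup>2 + 1"
proof (cases "D mod 4 = 1")
  case True
  interpret integer_basis D "(of_int 1 + s) / 2" "(of_int 1 - s) / 2" 1 "(1\<^sup>2 - D) div 4"
    by (rule integer_basis_1_mod_4[OF True]) simp
  obtain p where p: "p\<^sup>2 + p * 1 + (1\<^sup>2 - D) div 4 = - 1"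
    using ex_norm_minus_1_if_wr_classes wr unfolding field_lattice_eq by blast
  have "4 dvd 1\<^sup>2 - D * 1\<^sup>2" unfolding four_dvd_norm_iff using True by simp
  then have "4 * ((1\<^sup>2 - D) div 4) = 1 - D" by simp
  then have "D = (2 * p + 1)\<^sup>2 + 4" using p by (simp add: power2_eq_square algebra_simps)
  then show ?thesis using True by auto
next
  case False
  interpret integer_basis D "of_int 0 + s" "of_int 0 - s" "2 * 0" "0\<^sup>2 - D"
    by (rule integer_basis_not_1_mod_4[OF False])
  obtain p where "p\<^sup>2 + p * (2 * 0) + (0\<^sup>2 - D) = - 1"
    using ex_norm_minus_1_if_wr_classes wr unfolding field_lattice_eq by blast
  then have "D = p\<^sup>2 + 1" by simp
  then show ?thesis using False by auto
qed

lemma fundamental_unit_integral: "fundamental_unit D > 1 \<and> fundamental_unit D \<in> ring_of_integers D"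
proof (cases "D mod 4 = 1")
  case True
  interpret integer_basis D "(of_int 1 + s) / 2" "(of_int 1 - s) / 2" 1 "(1\<^sup>2 - D) div 4"
    by (rule integer_basis_1_mod_4[OF True]) simp
  show ?thesis by (rule fundamental_unit_integral)
next
  case False
  interpret integer_basis D "of_int 0 + s" "of_int 0 - s" "2 * 0" "0\<^sup>2 - D"
    by (rule integer_basis_not_1_mod_4[OF False])
  show ?thesis by (rule fundamental_unit_integral)
qed

text \<open>Squaring and comparing coordinates gives \<open>a * b = 0\<close>. If \<open>b\<close>
  were nonzero, \<open>D - k = b^2 * D\<close> would make \<open>D\<close> divide \<open>k\<close>,
  which is too small.\<close>

lemma sqrt_in_field_imp_square:
  assumes k: "0 < k" "k < D" and eq: "sqrt (of_int (D - k)) = of_int a + of_int b * s"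
  shows "D = a\<^sup>2 + k"
proof -
  have "of_int (D - k) = (of_int a + of_int b * s) * (of_int a + of_int b * s)"
    unfolding eq[symmetric] using k by simp
  also have "\<dots> = of_int (a\<^sup>2 + b\<^sup>2 * D) + of_int (2 * a * b) * s"
    by (simp add: s_sq[symmetric] power2_eq_square algebra_simps)
  finally have "of_int (D - k) + of_int 0 * s = of_int (a\<^sup>2 + b\<^sup>2 * D) + of_int (2 * a * b) * s" by simp
  from coords_unique[OF Rats_of_int Rats_of_int Rats_of_int Rats_of_int this]
  have "D - k = a\<^sup>2 + b\<^sup>2 * D" "0 = 2 * a * b" by (simp_all only: of_int_eq_iff)
  then have *: "D - k = a\<^sup>2 + b\<^sup>2 * D" "a = 0 \<or> b = 0" by auto
  have "b = 0"
  proof (rule ccontr)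
    assume "b \<noteq> 0"
    then have "D - k = b\<^sup>2 * D" using * by simp
    then have "D dvd k" by (metis dvd_diff_right_iff dvd_refl dvd_triv_right dvd_diff_commute)
    then show False using k zdvd_not_zless by blast
  qed
  then show ?thesis using * by simp
qed

text \<open>Injectivity of the logarithm identifies the given expression with the fundamental unit,
  so it is an algebraic integer of the field; subtracting \<open>s\<close> leaves a square root in
  the field.\<close>

lemma regulator_imp:
  assumes "D mod 4 = 1 \<Longrightarrow> regulator D = ln \<bar>1 / 2 * (sqrt (of_int (D - 4)) + s)\<bar>"
    and "D mod 4 \<noteq> 1 \<Longrightarrow> regulator D = ln \<bar>sqrt (of_int (D - 1)) + s\<bar>"
  shows "if D mod 4 = 1 then \<exists>c. D = c\<^sup>2 + 4 else \<exists>c. D = c\<^sup>2 + 1"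
proof (cases "D mod 4 = 1")
  case True
  then have D5: "4 < D" using D_gt_1 by presburger
  define X where "X = 1 / 2 * (sqrt (of_int (D - 4)) + s)"
  have "sqrt (of_int (D - 4)) \<ge> 0" using D5 by simp
  then have X: "X > 0" using add_nonneg_pos[OF _ s_pos] by (simp add: X_def)
  then have "ln (fundamental_unit D) = ln X" using assms(1)[OF True] by (simp add: regulator_def X_def)
  then have "X \<in> ring_of_integers D" using fundamental_unit_integral X by (metis exp_ln less_trans zero_less_one)
  then obtain m k where "X = of_int m / 2 + of_int k / 2 * s" unfolding ring_of_integers_iff by blast
  then have "sqrt (of_int (D - 4)) = of_int m + of_int (k - 1) * s"
    unfolding X_def by (simp add: field_simps)
  then have "D = m\<^sup>2 + 4" by (rule sqrt_in_field_imp_square[rotated 2]) (use D5 in simp_all)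
  then show ?thesis using True by auto
next
  case False
  define X where "X = sqrt (of_int (D - 1)) + s"
  have "sqrt (of_int (D - 1)) \<ge> 0" using D_gt_1 by simp
  then have X: "X > 0" using add_nonneg_pos[OF _ s_pos] by (simp add: X_def)
  then have "ln (fundamental_unit D) = ln X" using assms(2)[OF False] by (simp add: regulator_def X_def)
  then have "X \<in> ring_of_integers D" using fundamental_unit_integral X by (metis exp_ln less_trans zero_less_one)
  then obtain m k where mk: "4 dvd m\<^sup>2 - D * k\<^sup>2" "X = of_int m / 2 + of_int k / 2 * s"
    unfolding ring_of_integers_iff by blast
  \<comment> \<open>Outside residue 1 the halves cancel, which provides the integer coordinates
    needed for the square root.\<close>
  have "even m \<and> even k" using mk(1) unfolding four_dvd_norm_iff using False by simp
  then obtain a b where ab: "m = 2 * a" "k = 2 * b" by blast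
  have "sqrt (of_int (D - 1)) = of_int a + of_int (b - 1) * s"
    using mk(2) unfolding X_def ab by (simp add: algebra_simps)
  then have "D = a\<^sup>2 + 1" by (rule sqrt_in_field_imp_square[rotated 2]) (use D_gt_1 in simp_all)
  then show ?thesis using False by auto
qed

end

theorem theorem5p4:
  fixes D :: int
  assumes "D > 1" and "squarefree D"
  shows
    "(wr_classes (field_lattice D) = {similarity `` {int_lattice}}
      \<longleftrightarrow>
      ((\<exists>s::int. D = s\<^sup>2 + 1) \<and> D mod 4 = 2) \<or> ((\<exists>s::int. D = s\<^sup>2 + 4) \<and> D mod 4 = 1))
     \<and>
     (((\<exists>s::int. D = s\<^sup>2 + 1) \<and> D mod 4 = 2) \<or> ((\<exists>s::int. D = s\<^sup>2 + 4) \<and> D mod 4 = 1)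
      \<longleftrightarrow>
      (D mod 4 = 1 \<longrightarrow>
         regulator D = ln \<bar>1 / 2 * (sqrt (of_int (D - 4)) + sqrt (of_int D))\<bar>) \<and>
      (D mod 4 \<noteq> 1 \<longrightarrow>
         regulator D = ln \<bar>sqrt (of_int (D - 1)) + sqrt (of_int D)\<bar>))"
proof -
  interpret real_quadratic D using assms by unfold_locales
  \<comment> \<open>The common form of (ii), split only by whether \<open>D mod 4 = 1\<close>. Both
    (i) and (iii) imply it, and it implies both through the generating unit of norm
    \<open>-1\<close>.\<close>
  define P where "P = (if D mod 4 = 1 then \<exists>c. D = c\<^sup>2 + 4 else \<exists>c. D = c\<^sup>2 + 1)"
  define W where "W \<longleftrightarrow> wr_classes (field_lattice D) = {similarity `` {int_lattice}}"
  define R where "R \<longleftrightarrow> (D mod 4 = 1 \<longrightarrow>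
         regulator D = ln \<bar>1 / 2 * (sqrt (of_int (D - 4)) + sqrt (of_int D))\<bar>) \<and>
      (D mod 4 \<noteq> 1 \<longrightarrow>
         regulator D = ln \<bar>sqrt (of_int (D - 1)) + sqrt (of_int D)\<bar>)"
  have P: "((\<exists>s::int. D = s\<^sup>2 + 1) \<and> D mod 4 = 2) \<or> ((\<exists>s::int. D = s\<^sup>2 + 4) \<and> D mod 4 = 1) \<longleftrightarrow> P"
    unfolding P_def using sq_plus_1_mod_4 by auto
  have "W \<Longrightarrow> P" unfolding W_def P_def by (rule wr_classes_imp)
  moreover have "R \<Longrightarrow> P" unfolding R_def P_def s_def[symmetric] using regulator_imp by blast
  moreover have "W \<and> R" if p: P
  proof (cases "D mod 4 = 1")
    case True
    then obtain c where c: "D = c\<^sup>2 + 4" using p by (auto simp: P_def)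
    interpret pell_basis D "(of_int \<bar>c\<bar> + s) / 2" "(of_int \<bar>c\<bar> - s) / 2" "\<bar>c\<bar>" "- 1"
      by (rule pell_basis_1_mod_4[OF True c])
    have "sqrt (of_int (D - 4)) = of_int \<bar>c\<bar>" by (simp add: c)
    then show ?thesis using True wr_classes_field_lattice regulator_eq s_pos
      by (simp add: W_def R_def s_def[symmetric])
  next
    case False
    then obtain c where c: "D = c\<^sup>2 + 1" using p by (auto simp: P_def)
    interpret pell_basis D "of_int \<bar>c\<bar> + s" "of_int \<bar>c\<bar> - s" "2 * \<bar>c\<bar>" "- 1"
      by (rule pell_basis_not_1_mod_4[OF False c])
    have "sqrt (of_int (D - 1)) = of_int \<bar>c\<bar>" by (simp add: c)
    then show ?thesis using False wr_classes_field_lattice regulator_eq s_pos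
      by (simp add: W_def R_def s_def[symmetric])
  qed
  ultimately show ?thesis unfolding P W_def[symmetric] R_def[symmetric] by blast
qed

end
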